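(* Let $W=W(A_n)$ with simple system $\Pi$. Let $a_{KNP}$ be the structure constants of the algebra $\sum_W(A_n)$ and, for $J\subseteq\Pi$, let $a_{MNP}^J$ be the structure constants of the algebra $\sum_{W_J}(A_n)$ corresponding to the basis $\{[x_K^J] : K\subseteq J\}$. If $K,N\subseteq \Pi$, then $$[x_K][x_N]=\sum_{P\subseteq N}\Bigl(\sum_{M\subseteq J} a_{KJM}\,a_{MNP}^J\Bigr)[x_P]$$ for all $J\subseteq\Pi$ such that $N\subseteq J$. Moreover, the structure constants satisfy the identities $$a_{KNP}=\sum_{M\subseteq J} a_{KJM}\,a_{MNP}^J.$$
   Context: Let $e_1,\dots,e_{n+1}$ be an orthonormal basis of a Euclidean space of dimension $n+1$, $\Phi=\{e_i-e_j : i\ne j\}$ the root system of type $A_n$, $\Pi=\{e_i-e_{i+1} : 1\le i\le n\}$ its simple system, $\Phi^+$ the corresponding positive system, and $W=W(A_n)$ the Weyl group generated by the reflections $w_r$, $r\in\Phi$. For $J\subseteq\Pi$, $W_J$ is the standard parabolic subgroup generated by $w_r$, $r\in J$, and $X_J=\{w\in W : w(J)\subseteq\Phi^+\}$ is the set of distinguished (minimal length) representatives of the cosets $wW_J$. Put $X_{JK}=X_J^{-1}\cap X_K$, the set of distinguished representatives of the double cosets $W_JwW_K$. Algebra for $W$. Let $x_J=\sum_{d\in X_J} d$, and for $J,K,L\subseteq\Pi$ let $a_{JKL}$ be the number of $w\in X_{JK}$ with $w^{-1}(J)\cap K=L$. The $x_J$ form a basis of the (Solomon) descent algebra of $W$ over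 the rationals, with $x_Jx_K=\sum_{L\subseteq K}a_{JKL}x_L$. Define $x_J\sim x_K$, equivalently $J\sim K$, to mean $K=w(J)$ for some $w\in W$, and let $[x_J]$ denote the equivalence class of $x_J$. The algebra $\sum_W(A_n)$ is the span of the classes $[x_J]$, $J\subseteq \Pi$, the distinct classes forming a basis, with multiplication $[x_J][x_K]=[x_Jx_K]=\sum_{L\subseteq K}a_{JKL}[x_L]$. The structure constants $a_{JKL}$ are these integers, indexed by subsets $J,K,L$. Algebra for $W_J$. For $K\subseteq J\subseteq \Pi$ let $x_K^J=\sum_{d\in W_J\cap X_K}d$ (so $x_K^\Pi=x_K$), and let $[x_K^J]=\{x_L^J : L\sim K,\ L\subseteq J\}$, where $\sim$ is the relation above, i.e. $L=w(K)$ for some $w\in W$. The algebra $\sum_{W_J}(A_n)$ is the span of the classes $[x_K^J]$, $K\subseteq J$, which form its basis, with multiplication $[x_M^J][x_N^J]=[x_M^Jx_N^J]=\sum_{P\subseteq N}a_{MNP}^J[x_P^J]$ for $M,N\subseteq J$, where $a_{MNP}^J$ is the number of $w\in W_J\cap X_{MN}$ with $w^{-1}(M)\cap N=P$. *)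

theory Defs
  imports "HOL-Analysis.Analysis" "HOL-Algebra.Generated_Groups" "HOL-Library.Poly_Mapping"
begin

section \<open>The Weyl group of type A\<close>

text \<open>
  Throughout, \<open>e 1, \<dots>, e (n + 1)\<close> is meant to be an orthonormal basis of a Euclidean space
  \<open>'a\<close> of dimension \<open>n + 1\<close>; elements of the Weyl group are maps \<open>'a \<Rightarrow> 'a\<close>.
\<close>

definition roots :: "(nat \<Rightarrow> 'a::euclidean_space) \<Rightarrow> nat \<Rightarrow> 'a set" where
  "roots e n = {e i - e j | i j. i \<in> {1..n+1} \<and> j \<in> {1..n+1} \<and> i \<noteq> j}"

definition simple_roots :: "(nat \<Rightarrow> 'a::euclidean_space) \<Rightarrow> nat \<Rightarrow> 'a set" where
  "simple_roots e n = {e i - e (i + 1) | i. i \<in> {1..n}}"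

definition pos_roots :: "(nat \<Rightarrow> 'a::euclidean_space) \<Rightarrow> nat \<Rightarrow> 'a set" where
  "pos_roots e n = {r \<in> roots e n.
     \<exists>c :: 'a \<Rightarrow> real. (\<forall>s \<in> simple_roots e n. 0 \<le> c s) \<and> r = (\<Sum>s\<in>simple_roots e n. c s *\<^sub>R s)}"

definition root_reflection :: "'a::euclidean_space \<Rightarrow> 'a \<Rightarrow> 'a" where
  "root_reflection r v = v - (2 * (v \<bullet> r) / (r \<bullet> r)) *\<^sub>R r"

definition orthogonal_group :: "('a::euclidean_space \<Rightarrow> 'a) monoid" where
  "orthogonal_group = \<lparr>carrier = {f. orthogonal_transformation f}, monoid.mult = (\<circ>), one = id\<rparr>"

definition reflection_group :: "'a::euclidean_space set \<Rightarrow> ('a \<Rightarrow> 'a) set" where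
  "reflection_group R = generate orthogonal_group (root_reflection ` R)"

abbreviation weyl_group :: "(nat \<Rightarrow> 'a::euclidean_space) \<Rightarrow> nat \<Rightarrow> ('a \<Rightarrow> 'a) set" where
  "weyl_group e n \<equiv> reflection_group (roots e n)"

abbreviation parabolic :: "'a::euclidean_space set \<Rightarrow> ('a \<Rightarrow> 'a) set" where
  "parabolic J \<equiv> reflection_group J"

definition coset_reps ::
    "(nat \<Rightarrow> 'a::euclidean_space) \<Rightarrow> nat \<Rightarrow> 'a set \<Rightarrow> ('a \<Rightarrow> 'a) set" where
  "coset_reps e n J = {w \<in> weyl_group e n. w ` J \<subseteq> pos_roots e n}"

text \<open>
  The inverse function is written \<open>inv_into UNIV\<close>, since HOL-Algebra
  reserves the token \<open>inv\<close> for inverses in a group structure.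
\<close>

definition double_coset_reps ::
    "(nat \<Rightarrow> 'a::euclidean_space) \<Rightarrow> nat \<Rightarrow> 'a set \<Rightarrow> 'a set \<Rightarrow> ('a \<Rightarrow> 'a) set" where
  "double_coset_reps e n J K = inv_into UNIV ` coset_reps e n J \<inter> coset_reps e n K"

definition struct_const ::
    "(nat \<Rightarrow> 'a::euclidean_space) \<Rightarrow> nat \<Rightarrow> 'a set \<Rightarrow> 'a set \<Rightarrow> 'a set \<Rightarrow> nat" where
  "struct_const e n J K L =
     card {w \<in> double_coset_reps e n J K. inv_into UNIV w ` J \<inter> K = L}"

definition struct_const_rel ::
    "(nat \<Rightarrow> 'a::euclidean_space) \<Rightarrow> nat \<Rightarrow> 'a set \<Rightarrow> 'a set \<Rightarrow> 'a set \<Rightarrow> 'a set \<Rightarrow> nat" where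
  "struct_const_rel e n J M N P =
     card {w \<in> parabolic J \<inter> double_coset_reps e n M N. inv_into UNIV w ` M \<inter> N = P}"

definition weyl_conj :: "(nat \<Rightarrow> 'a::euclidean_space) \<Rightarrow> nat \<Rightarrow> 'a set \<Rightarrow> 'a set \<Rightarrow> bool" where
  "weyl_conj e n J K \<longleftrightarrow> (\<exists>w \<in> weyl_group e n. K = w ` J)"


section \<open>Rational vector spaces with a given basis, and the group algebra\<close>

definition qscale :: "rat \<Rightarrow> ('k \<Rightarrow>\<^sub>0 rat) \<Rightarrow> 'k \<Rightarrow>\<^sub>0 rat" where
  "qscale c f = Poly_Mapping.map ((*) c) f"

lemma lookup_qscale [simp]: "Poly_Mapping.lookup (qscale c f) k = c * Poly_Mapping.lookup f k"
  by (simp add: qscale_def Poly_Mapping.map.rep_eq when_def)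

global_interpretation qvec: vector_space "qscale :: rat \<Rightarrow> ('k \<Rightarrow>\<^sub>0 rat) \<Rightarrow> 'k \<Rightarrow>\<^sub>0 rat"
  by unfold_locales (auto intro!: poly_mapping_eqI simp: lookup_add algebra_simps)

text \<open>
  The group algebra product, the bilinear extension of composition. The product of type
  class \<^class>\<open>times\<close> on \<open>'g \<Rightarrow>\<^sub>0 rat\<close> is not applicable: it is built from \<open>+\<close> on \<open>'g\<close>.
\<close>

definition group_alg_mult ::
    "(('a \<Rightarrow> 'a) \<Rightarrow>\<^sub>0 rat) \<Rightarrow> (('a \<Rightarrow> 'a) \<Rightarrow>\<^sub>0 rat) \<Rightarrow> ('a \<Rightarrow> 'a) \<Rightarrow>\<^sub>0 rat" where
  "group_alg_mult f g =
     (\<Sum>u\<in>Poly_Mapping.keys f. \<Sum>v\<in>Poly_Mapping.keys g.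
        Poly_Mapping.single (u \<circ> v) (Poly_Mapping.lookup f u * Poly_Mapping.lookup g v))"

definition x_elem ::
    "(nat \<Rightarrow> 'a::euclidean_space) \<Rightarrow> nat \<Rightarrow> 'a set \<Rightarrow> ('a \<Rightarrow> 'a) \<Rightarrow>\<^sub>0 rat" where
  "x_elem e n J = (\<Sum>d\<in>coset_reps e n J. Poly_Mapping.single d 1)"


section \<open>The algebra of classes\<close>

text \<open>
  Elements of the algebra are formal rational combinations of equivalence classes
  \<open>{x\<^sub>K. K \<sim> J}\<close>, which are sets of elements of the group algebra.
\<close>

type_synonym 'a class_comb = "(('a \<Rightarrow> 'a) \<Rightarrow>\<^sub>0 rat) set \<Rightarrow>\<^sub>0 rat"

definition x_class ::
    "(nat \<Rightarrow> 'a::euclidean_space) \<Rightarrow> nat \<Rightarrow> 'a set \<Rightarrow> (('a \<Rightarrow> 'a) \<Rightarrow>\<^sub>0 rat) set" where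
  "x_class e n J = {x_elem e n K | K. K \<subseteq> simple_roots e n \<and> weyl_conj e n J K}"

definition basis_class ::
    "(nat \<Rightarrow> 'a::euclidean_space) \<Rightarrow> nat \<Rightarrow> 'a set \<Rightarrow> 'a class_comb" where
  "basis_class e n J = Poly_Mapping.single (x_class e n J) 1"

text \<open>
  The linear extension of \<open>x\<^sub>J \<mapsto> [x\<^sub>J]\<close> to the descent algebra, the span of the
  basis consisting of all \<open>x\<^sub>J\<close>; only its values on that span are meaningful.
\<close>

definition bracket ::
    "(nat \<Rightarrow> 'a::euclidean_space) \<Rightarrow> nat \<Rightarrow> (('a \<Rightarrow> 'a) \<Rightarrow>\<^sub>0 rat) \<Rightarrow> 'a class_comb" where
  "bracket e n u =
     (\<Sum>J\<in>Pow (simple_roots e n).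
        qscale (qvec.representation (x_elem e n ` Pow (simple_roots e n)) u (x_elem e n J))
               (basis_class e n J))"

text \<open>
  The product of two basis classes is \<open>[x y]\<close> for representatives \<open>x\<close> and \<open>y\<close>. The definite
  description records that it does not depend on their choice.
\<close>

definition class_prod ::
    "(nat \<Rightarrow> 'a::euclidean_space) \<Rightarrow> nat \<Rightarrow>
     (('a \<Rightarrow> 'a) \<Rightarrow>\<^sub>0 rat) set \<Rightarrow> (('a \<Rightarrow> 'a) \<Rightarrow>\<^sub>0 rat) set \<Rightarrow> 'a class_comb" where
  "class_prod e n C D = (THE z. \<forall>x\<in>C. \<forall>y\<in>D. z = bracket e n (group_alg_mult x y))"

definition class_mult ::
    "(nat \<Rightarrow> 'a::euclidean_space) \<Rightarrow> nat \<Rightarrow> 'a class_comb \<Rightarrow> 'a class_comb \<Rightarrow> 'a class_comb" where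
  "class_mult e n a b =
     (\<Sum>C\<in>Poly_Mapping.keys a. \<Sum>D\<in>Poly_Mapping.keys b.
        qscale (Poly_Mapping.lookup a C * Poly_Mapping.lookup b D) (class_prod e n C D))"

end

(*
  Let X_J be the distinguished representatives of W / W_J and X_KJ those of the double cosets.
  Every w with w^-1 in X_K factors uniquely as w = d v with d in X_KJ, v in W_J and v^-1 in X_M,
  where M is the intersection of d^-1(K) and J. If N is contained in J, then d v lies in X_N iff
  v does, and w^-1(K) and v^-1(M) meet N in the same set; counting the pairs (d, v) gives the
  identity between the structure constants.

  The same factorization gives Solomon's formula, x_K x_N being the sum of x_L(w) over w in X_KN
  with L(w) the intersection of w^-1(K) and N. The product of classes does not depend on the
  representatives: conjugating K and N by elements of W permutes the double cosets, and the
  class of L(w) is determined by the roots r in span N with w r in span K.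
*)
theory Submission
  imports Defs
begin

text \<open>Everything rests on a dichotomy for a positive root r and a set J of simple roots: if r
  is not in span J, elements of W_J keep it positive; if it is, elements of X_J keep it positive.
  Both facts come from linear functionals (height and coefficients), so positivity does the work
  usually done by length. Passing from span J to J is a separate obstacle, since M and L(w) are sets
  of simple roots; height settles it: a root of span J that an element of X_J sends to a simple root
  lies in J (\<open>coset_rep_simple_imp_simple\<close>). Different subsets P of N can have the same
  class, so the product formula does not determine the numbers a_KNP. Their identity is therefore
  proved by counting, apart from the algebra, and then substituted into
  \<open>class_mult_basis_class\<close>. The algebra has its own burden: \<open>class_prod\<close>
  is a definite description over all representatives, and \<open>bracket\<close> takes coordinates
  in the basis of all x_J, so linear independence and independence of representatives have to be
  established.\<close>

section \<open>Reflection groups\<close>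

lemma orthogonal_transformation_root_reflection: "orthogonal_transformation (root_reflection r)"
proof -
  have "linear (root_reflection r)"
    by (rule linearI)
      (auto simp: root_reflection_def algebra_simps inner_add_left add_divide_distrib
        simp flip: scaleR_add_left)
  moreover have "root_reflection r v \<bullet> root_reflection r w = v \<bullet> w" for v w
    by (cases "r = 0")
      (auto simp: root_reflection_def inner_diff_left inner_diff_right inner_commute field_simps)
  ultimately show ?thesis
    by (simp add: orthogonal_transformation_def)
qed

lemma root_reflection_involution: "root_reflection r \<circ> root_reflection r = id"
proof
  fix v
  show "(root_reflection r \<circ> root_reflection r) v = id v"
    by (cases "r = 0")
      (auto simp: root_reflection_def inner_diff_left algebra_simps)
qed

lemma root_reflection_conj:
  assumes "orthogonal_transformation f"
  shows "f \<circ> root_reflection r = root_reflection (f r) \<circ> f"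
proof
  fix v
  have "linear f" "f v \<bullet> f r = v \<bullet> r" "f r \<bullet> f r = r \<bullet> r"
    using assms by (auto simp: orthogonal_transformation_def)
  then show "(f \<circ> root_reflection r) v = (root_reflection (f r) \<circ> f) v"
    by (simp add: root_reflection_def linear_diff linear_scale)
qed

lemma group_orthogonal_group: "group (orthogonal_group :: ('a::euclidean_space \<Rightarrow> 'a) monoid)"
proof (rule groupI)
  fix f :: "'a \<Rightarrow> 'a" assume "f \<in> carrier orthogonal_group"
  then have "orthogonal_transformation f"
    by (simp add: orthogonal_group_def)
  then show "\<exists>g\<in>carrier orthogonal_group. g \<otimes>\<^bsub>orthogonal_group\<^esub> f = \<one>\<^bsub>orthogonal_group\<^esub>"
    by (intro bexI[of _ "inv_into UNIV f"])
      (auto simp: orthogonal_group_def orthogonal_transformation_inv orthogonal_transformation_inj)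
qed (auto simp: orthogonal_group_def id_def o_assoc intro: orthogonal_transformation_compose)

lemma inv_root_reflection: "inv\<^bsub>orthogonal_group\<^esub> (root_reflection r) = root_reflection r"
  using orthogonal_transformation_root_reflection[of r] root_reflection_involution[of r]
  by (intro group.inv_equality[OF group_orthogonal_group]) (auto simp: orthogonal_group_def)

lemma id_in_reflection_group: "id \<in> reflection_group R"
  using generate.one[of orthogonal_group] by (simp add: reflection_group_def orthogonal_group_def)

lemma root_reflection_in_reflection_group: "r \<in> R \<Longrightarrow> root_reflection r \<in> reflection_group R"
  by (auto simp: reflection_group_def intro: generate.incl)

lemma comp_in_reflection_group:
  assumes "u \<in> reflection_group R" "v \<in> reflection_group R"
  shows "u \<circ> v \<in> reflection_group R"
  using generate.eng[OF assms[unfolded reflection_group_def]]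
  by (simp add: reflection_group_def orthogonal_group_def)

text \<open>Three cases suffice although \<open>generate\<close> has four: a reflection is its own
  inverse, so the case of inverses of generators folds into the reflection case.\<close>

lemma reflection_group_induct [consumes 1, case_names id reflection comp]:
  assumes "w \<in> reflection_group R"
    and "P id"
    and "\<And>r. r \<in> R \<Longrightarrow> P (root_reflection r)"
    and "\<And>u v. u \<in> reflection_group R \<Longrightarrow> v \<in> reflection_group R \<Longrightarrow> P u \<Longrightarrow> P v \<Longrightarrow> P (u \<circ> v)"
  shows "P w"
  using assms(1) unfolding reflection_group_def
proof (induction rule: generate.induct)
  case one
  then show ?case using assms(2) by (simp add: orthogonal_group_def id_def)
next
  case (incl h)
  then show ?case using assms(3) by auto
next
  case (inv h)
  then show ?case using assms(3) by (auto simp: inv_root_reflection)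
next
  case (eng h1 h2)
  then have "P (h1 \<circ> h2)"
    using assms(4)[unfolded reflection_group_def] by blast
  then show ?case by (simp add: orthogonal_group_def comp_def)
qed

lemma reflection_group_orthogonal: "w \<in> reflection_group R \<Longrightarrow> orthogonal_transformation w"
proof (induction rule: reflection_group_induct)
  case id
  then show ?case by (simp add: id_def)
qed (blast intro: orthogonal_transformation_root_reflection orthogonal_transformation_compose)+

lemma reflection_group_linear: "w \<in> reflection_group R \<Longrightarrow> linear w"
  using orthogonal_transformation_def reflection_group_orthogonal by blast

lemma reflection_group_bij: "w \<in> reflection_group R \<Longrightarrow> bij w"
  using orthogonal_transformation_bij reflection_group_orthogonal by blast

lemma inv_in_reflection_group: "w \<in> reflection_group R \<Longrightarrow> inv_into UNIV w \<in> reflection_group R"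
proof (induction rule: reflection_group_induct)
  case id
  then show ?case using id_in_reflection_group by (simp add: id_def)
next
  case (reflection r)
  then show ?case
    using inv_unique_comp[OF root_reflection_involution root_reflection_involution, of r]
      root_reflection_in_reflection_group[of r R] by simp
next
  case (comp u v)
  then have "inv_into UNIV (u \<circ> v) = inv_into UNIV v \<circ> inv_into UNIV u"
    by (intro o_inv_distrib reflection_group_bij)
  with comp show ?case
    using comp_in_reflection_group[of "inv_into UNIV v" R "inv_into UNIV u"] by metis
qed

lemma reflection_group_mono:
  assumes "R \<subseteq> S"
  shows "reflection_group R \<subseteq> reflection_group S"
proof
  fix w assume "w \<in> reflection_group R"
  then show "w \<in> reflection_group S"
    using assms
    by (induction rule: reflection_group_induct)
      (auto intro: id_in_reflection_group root_reflection_in_reflection_group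
        comp_in_reflection_group)
qed

text \<open>A reflection subtracts a multiple of its root. The use is that linear functionals
  vanishing on \<open>R\<close> are invariant under the group that \<open>R\<close>
  generates.\<close>

lemma reflection_group_moves_in_span: "w \<in> reflection_group R \<Longrightarrow> w x - x \<in> span R"
proof (induction arbitrary: x rule: reflection_group_induct)
  case id
  then show ?case by (simp add: span_zero)
next
  case (reflection r)
  have "- ((2 * (x \<bullet> r) / (r \<bullet> r)) *\<^sub>R r) \<in> span R"
    using reflection by (intro span_neg span_scale span_base)
  then show ?case by (simp add: root_reflection_def)
next
  case (comp u v)
  from span_add[OF comp(3)[of "v x"] comp(4)[of x]] show ?case by simp
qed

lemma reflection_group_span_iff:
  assumes "w \<in> reflection_group R"
  shows "w x \<in> span R \<longleftrightarrow> x \<in> span R"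
  using reflection_group_moves_in_span[OF assms, of x] span_add_eq[of "w x - x" R x] by simp

lemma reflection_group_conj:
  fixes f :: "'a::euclidean_space \<Rightarrow> 'a"
  assumes "w \<in> reflection_group R" "orthogonal_transformation f" "f ` R \<subseteq> S"
  shows "f \<circ> w \<circ> inv_into UNIV f \<in> reflection_group S"
  using assms(1)
proof (induction rule: reflection_group_induct)
  case id
  have "f \<circ> id \<circ> inv_into UNIV f = id"
    using orthogonal_transformation_surj[OF assms(2)] by (simp add: surj_iff)
  then show ?case
    using id_in_reflection_group[of S] by metis
next
  case (reflection r)
  have "f \<circ> inv_into UNIV f = id"
    using orthogonal_transformation_surj[OF assms(2)] by (simp add: surj_iff)
  then have "f \<circ> root_reflection r \<circ> inv_into UNIV f = root_reflection (f r)"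
    by (simp add: root_reflection_conj[OF assms(2)] comp_assoc)
  then show ?case
    using reflection assms(3) root_reflection_in_reflection_group[of "f r" S] by (metis image_subset_iff)
next
  case (comp u v)
  have "inv_into UNIV f \<circ> f = id"
    using orthogonal_transformation_inj[OF assms(2)] by simp
  then have "f \<circ> (u \<circ> v) \<circ> inv_into UNIV f
      = (f \<circ> u \<circ> inv_into UNIV f) \<circ> (f \<circ> v \<circ> inv_into UNIV f)"
    by (metis comp_assoc comp_id)
  with comp show ?case using comp_in_reflection_group by metis
qed

abbreviation inverse_map :: "('b \<Rightarrow> 'b) \<Rightarrow> 'b \<Rightarrow> 'b" ("_\<^sup>-" [1000] 1000) where
  "w\<^sup>- \<equiv> inv_into UNIV w"

lemma reflection_group_inv_simps:
  assumes "w \<in> reflection_group R"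
  shows "w (w\<^sup>- x) = x" "w\<^sup>- (w x) = x" "(w\<^sup>-)\<^sup>- = w" "w \<circ> w\<^sup>- = id" "w\<^sup>- \<circ> w = id"
  using reflection_group_bij[OF assms]
  by (simp_all add: bij_is_surj bij_is_inj surj_f_inv_f inv_inv_eq flip: surj_iff)

lemma reflection_group_inv_comp:
  "u \<in> reflection_group R \<Longrightarrow> v \<in> reflection_group R \<Longrightarrow> (u \<circ> v)\<^sup>- = v\<^sup>- \<circ> u\<^sup>-"
  by (intro o_inv_distrib reflection_group_bij)

text \<open>Such an f grows by at least 1 per step: climbing from i to m bounds \<open>f i\<close>
  above by i, climbing from 1 to i bounds it below. It will be the index permutation of a Weyl group
  element that preserves positivity.\<close>

lemma strict_mono_on_interval_eq:
  fixes f :: "nat \<Rightarrow> nat"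
  assumes mono: "\<And>i j. i \<in> {1..m} \<Longrightarrow> j \<in> {1..m} \<Longrightarrow> i < j \<Longrightarrow> f i < f j"
    and range: "\<And>i. i \<in> {1..m} \<Longrightarrow> f i \<in> {1..m}" and i: "i \<in> {1..m}"
  shows "f i = i"
proof (rule antisym)
  have "f i + k \<le> f (i + k)" if "i + k \<le> m" for k
    using that
  proof (induction k)
    case (Suc k)
    then show ?case using mono[of "i + k" "i + Suc k"] i by fastforce
  qed simp
  from this[of "m - i"] range[of m] i show "f i \<le> i" by simp linarith
  have "j + 1 \<le> f (j + 1)" if "j + 1 \<le> m" for j
    using that
  proof (induction j)
    case 0
    then show ?case using range[of 1] by simp
  next
    case (Suc j)
    then show ?case using mono[of "Suc j" "Suc (Suc j)"] by simp
  qed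
  from this[of "i - 1"] i show "i \<le> f i" by simp
qed

section \<open>Roots of type A\<close>

locale type_A =
  fixes e :: "nat \<Rightarrow> 'a::euclidean_space" and n :: nat
  assumes dim: "DIM('a) = n + 1"
    and inner_e: "\<And>i j. i \<in> {1..n+1} \<Longrightarrow> j \<in> {1..n+1} \<Longrightarrow> e i \<bullet> e j = (if i = j then 1 else 0)"
begin

definition indices :: "nat set" where
  "indices = {1..n+1}"

lemma finite_indices: "finite indices"
  by (simp add: indices_def)

lemma indices_iff: "i \<in> indices \<longleftrightarrow> 1 \<le> i \<and> i \<le> n + 1"
  by (auto simp: indices_def)

lemma inner_e_indices: "i \<in> indices \<Longrightarrow> j \<in> indices \<Longrightarrow> e i \<bullet> e j = (if i = j then 1 else 0)"
  unfolding indices_def by (rule inner_e)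

lemma roots_eq: "roots e n = {e i - e j | i j. i \<in> indices \<and> j \<in> indices \<and> i \<noteq> j}"
  by (simp only: roots_def indices_def)

lemma simple_roots_eq: "simple_roots e n = (\<lambda>k. e k - e (Suc k)) ` {1..n}"
  by (auto simp: simple_roots_def)

text \<open>The height functional: e_i - e_j pairs to j - i with it, so simple roots have height 1.
  The minus sign makes the roots with i < j the positive ones.\<close>

definition rho :: 'a where
  "rho = - (\<Sum>i\<in>indices. real i *\<^sub>R e i)"

text \<open>Up to a multiple of the sum of all e_i, the k-th fundamental weight: pairing a root with
  it reads off the coefficient of the simple root e_k - e_(k+1).\<close>

definition omega :: "nat \<Rightarrow> 'a" where
  "omega k = (\<Sum>i\<in>{1..k}. e i)"

lemma inj_e: "inj_on e indices"
proof (rule inj_onI)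
  fix i j assume "i \<in> indices" "j \<in> indices" "e i = e j"
  then show "i = j"
    using inner_e_indices[of i i] inner_e_indices[of i j] by (simp split: if_splits)
qed

lemma e_eq_iff: "i \<in> indices \<Longrightarrow> j \<in> indices \<Longrightarrow> e i = e j \<longleftrightarrow> i = j"
  using inj_e by (meson inj_on_eq_iff)

lemma inner_e_rho:
  assumes "i \<in> indices"
  shows "e i \<bullet> rho = - real i"
proof -
  have "e i \<bullet> (\<Sum>j\<in>indices. real j *\<^sub>R e j) = (\<Sum>j\<in>indices. if i = j then real j else 0)"
    unfolding inner_sum_right using assms
    by (intro sum.cong refl) (simp add: inner_e_indices)
  also have "\<dots> = real i"
    using assms by (simp add: finite_indices)
  finally show ?thesis by (simp only: rho_def inner_minus_right)
qed

lemma inner_e_omega: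
  assumes "i \<in> indices" "k \<le> n"
  shows "e i \<bullet> omega k = (if i \<le> k then 1 else 0)"
proof -
  have "e i \<bullet> omega k = (\<Sum>j\<in>{1..k}. if i = j then 1 else 0)"
    unfolding omega_def inner_sum_right
    using assms by (intro sum.cong) (auto simp: inner_e_indices indices_iff)
  then show ?thesis using assms by (simp add: indices_iff)
qed

lemma span_e: "span (e ` indices) = UNIV"
proof -
  have "pairwise orthogonal (e ` indices)"
    by (auto simp: pairwise_def orthogonal_def inner_e_indices)
  moreover have "0 \<notin> e ` indices"
    using inner_e_indices by (metis imageE inner_zero_left zero_neq_one)
  ultimately have "independent (e ` indices)"
    by (rule pairwise_orthogonal_independent)
  moreover have "card (e ` indices) = DIM('a)"
    unfolding card_image[OF inj_e] by (simp add: dim indices_def)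
  ultimately show ?thesis
    using card_ge_dim_independent[of "e ` indices" UNIV] by auto
qed

lemma rootE:
  assumes "r \<in> roots e n"
  obtains i j where "i \<in> indices" "j \<in> indices" "i \<noteq> j" "r = e i - e j"
  using assms by (auto simp: roots_eq)

lemma simple_rootE:
  assumes "r \<in> simple_roots e n"
  obtains i where "i \<in> {1..n}" "r = e i - e (Suc i)"
  using assms by (auto simp: simple_roots_eq)

lemma simple_subset_roots: "simple_roots e n \<subseteq> roots e n"
  unfolding simple_roots_eq roots_eq by (force simp: indices_iff)

lemma finite_roots: "finite (roots e n)"
proof -
  have "roots e n \<subseteq> (\<lambda>(i, j). e i - e j) ` (indices \<times> indices)"
    by (auto simp: roots_eq)
  then show ?thesis by (rule finite_subset) (simp add: finite_indices)
qed

lemma finite_simple_roots: "finite (simple_roots e n)"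
  using finite_roots simple_subset_roots finite_subset by blast

lemma uminus_root: "r \<in> roots e n \<Longrightarrow> - r \<in> roots e n"
  unfolding roots_eq by force

lemma inner_root_rho:
  "i \<in> indices \<Longrightarrow> j \<in> indices \<Longrightarrow> (e i - e j) \<bullet> rho = real j - real i"
  by (simp add: inner_diff_left inner_e_rho)

lemma root_inner_rho_nonzero: "r \<in> roots e n \<Longrightarrow> r \<bullet> rho \<noteq> 0"
  by (elim rootE) (simp add: inner_root_rho)

lemma simple_root_inner_rho: "r \<in> simple_roots e n \<Longrightarrow> r \<bullet> rho = 1"
  by (elim simple_rootE) (simp add: inner_root_rho indices_iff)

lemma root_telescope:
  "i \<le> j \<Longrightarrow> e i - e j = (\<Sum>k\<in>{i..<j}. e k - e (Suc k))"
  using sum_Suc_diff'[of i j "\<lambda>k. - e k"] by simp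

lemma inj_simple_root: "inj_on (\<lambda>k. e k - e (Suc k)) {1..n}"
proof (rule inj_onI)
  fix i j assume ij: "i \<in> {1..n}" "j \<in> {1..n}" and eq: "e i - e (Suc i) = e j - e (Suc j)"
  have "(e i - e (Suc i)) \<bullet> omega i = (e j - e (Suc j)) \<bullet> omega i"
    by (simp add: eq)
  then show "i = j"
    using ij by (simp add: inner_diff_left inner_e_omega indices_iff split: if_splits)
qed

text \<open>Trades a condition on coefficients for the sign of one functional. A nonnegative
  combination has nonnegative height and no root has height 0; conversely, e_i - e_j with i < j
  telescopes into simple roots, so coefficients 0 and 1 suffice.\<close>

lemma pos_roots_iff_rho: "r \<in> pos_roots e n \<longleftrightarrow> r \<in> roots e n \<and> r \<bullet> rho > 0"
proof (intro iffI conjI)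
  assume r: "r \<in> pos_roots e n"
  then show root: "r \<in> roots e n" by (simp add: pos_roots_def)
  obtain c :: "'a \<Rightarrow> real" where c: "\<forall>s \<in> simple_roots e n. 0 \<le> c s"
    "r = (\<Sum>s\<in>simple_roots e n. c s *\<^sub>R s)"
    using r by (auto simp: pos_roots_def)
  have "r \<bullet> rho = (\<Sum>s\<in>simple_roots e n. c s)"
    by (simp add: c(2) inner_sum_left simple_root_inner_rho)
  also have "\<dots> \<ge> 0" using c(1) by (simp add: sum_nonneg)
  finally show "r \<bullet> rho > 0"
    using root_inner_rho_nonzero[OF root] by simp
next
  assume r: "r \<in> roots e n \<and> r \<bullet> rho > 0"
  then obtain i j where ij: "i \<in> indices" "j \<in> indices" "r = e i - e j" "i < j"
    by (auto elim!: rootE simp: inner_root_rho)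
  define S where "S = (\<lambda>k. e k - e (Suc k)) ` {i..<j}"
  have sub: "{i..<j} \<subseteq> {1..n}" using ij by (auto simp: indices_iff)
  have "S \<subseteq> simple_roots e n"
    using sub by (auto simp: S_def simple_roots_eq)
  then have "(\<Sum>s\<in>simple_roots e n. (if s \<in> S then 1 else 0) *\<^sub>R s) = \<Sum>S"
    by (simp add: if_distrib[of "\<lambda>x. x *\<^sub>R _"] sum.inter_restrict[OF finite_simple_roots, symmetric]
        Int_absorb1 cong: if_cong)
  also have "\<dots> = r"
    unfolding S_def ij(3) root_telescope[OF less_imp_le[OF ij(4)]]
    by (simp add: sum.reindex[OF inj_on_subset[OF inj_simple_root sub]])
  finally show "r \<in> pos_roots e n"
    using r unfolding pos_roots_def
    by (auto intro!: exI[of _ "\<lambda>s. if s \<in> S then 1 else 0"])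
qed

lemma pos_rootE:
  assumes "r \<in> pos_roots e n"
  obtains i j where "i \<in> indices" "j \<in> indices" "i < j" "r = e i - e j"
  using assms by (auto simp: pos_roots_iff_rho inner_root_rho elim!: rootE)

lemma root_pos_or_neg: "r \<in> roots e n \<Longrightarrow> r \<in> pos_roots e n \<or> - r \<in> pos_roots e n"
  using root_inner_rho_nonzero[of r] uminus_root[of r] by (auto simp: pos_roots_iff_rho)

lemma pos_root_uminus_not_pos: "r \<in> pos_roots e n \<Longrightarrow> - r \<notin> pos_roots e n"
  by (auto simp: pos_roots_iff_rho)

lemma simple_subset_pos: "simple_roots e n \<subseteq> pos_roots e n"
  using simple_subset_roots simple_root_inner_rho by (auto simp: pos_roots_iff_rho)

lemma pos_root_inner_rho_ge_1: "r \<in> pos_roots e n \<Longrightarrow> r \<bullet> rho \<ge> 1"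
  by (elim pos_rootE) (simp add: inner_root_rho)

lemma inner_omega_span:
  assumes "J \<subseteq> simple_roots e n" "k \<in> {1..n}" "e k - e (Suc k) \<notin> J" "x \<in> span J"
  shows "x \<bullet> omega k = 0"
proof -
  have "J \<subseteq> {x. x \<bullet> omega k = 0}"
  proof
    fix s assume "s \<in> J"
    then obtain i where i: "i \<in> {1..n}" "s = e i - e (Suc i)"
      using assms(1) by (meson simple_rootE subsetD)
    then have "i \<noteq> k" using assms(3) \<open>s \<in> J\<close> by auto
    then show "s \<in> {x. x \<bullet> omega k = 0}"
      using i assms(2) inner_e_omega[of i k] inner_e_omega[of "Suc i" k]
      by (auto simp: inner_diff_left indices_iff)
  qed
  moreover have "subspace {x. x \<bullet> omega k = 0}"
    by (auto simp: subspace_def inner_add_left)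
  ultimately show ?thesis
    using span_minimal assms(4) by blast
qed

text \<open>The functional \<open>omega k\<close> takes the value 1 on e_i - e_j, but it vanishes on
  span J as soon as the k-th simple root is missing from J.\<close>

lemma simple_roots_of_pos_root_in_span:
  assumes "J \<subseteq> simple_roots e n" "i \<in> indices" "j \<in> indices" "e i - e j \<in> span J" "k \<in> {i..<j}"
  shows "e k - e (Suc k) \<in> J"
proof (rule ccontr)
  assume "e k - e (Suc k) \<notin> J"
  then have "(e i - e j) \<bullet> omega k = 0"
    using assms by (intro inner_omega_span[of J]) (auto simp: indices_iff)
  then show False
    using assms inner_e_omega[of i k] inner_e_omega[of j k]
    by (auto simp: inner_diff_left indices_iff)
qed

lemma root_pos_iff_omega:
  assumes "r \<in> roots e n" "k \<le> n" "r \<bullet> omega k > 0"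
  shows "r \<in> pos_roots e n"
proof -
  obtain i j where ij: "i \<in> indices" "j \<in> indices" "r = e i - e j"
    using assms(1) by (rule rootE)
  then have "i < j"
    using assms(2,3) by (simp add: inner_diff_left inner_e_omega split: if_splits)
  then show ?thesis
    using assms(1) ij by (simp add: pos_roots_iff_rho inner_root_rho)
qed

section \<open>The Weyl group as a permutation group of the basis vectors\<close>

lemma root_reflection_e:
  assumes "i \<in> indices" "j \<in> indices" "i \<noteq> j" "k \<in> indices"
  shows "root_reflection (e i - e j) (e k) = e (if k = i then j else if k = j then i else k)"
proof -
  have "(e i - e j) \<bullet> (e i - e j) = 2"
    using assms by (simp only: inner_diff_left inner_diff_right inner_e_indices) simp
  moreover have "e k \<bullet> (e i - e j) = (if k = i then 1 else if k = j then -1 else 0)"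
    using assms by (simp only: inner_diff_left inner_diff_right inner_e_indices) simp
  ultimately show ?thesis
    by (simp add: root_reflection_def)
qed

lemma weyl_group_permutes_e:
  assumes "w \<in> weyl_group e n"
  shows "w ` e ` indices \<subseteq> e ` indices"
  using assms
proof (induction rule: reflection_group_induct)
  case (reflection r)
  then show ?case
    by (elim rootE) (auto simp: root_reflection_e)
next
  case (comp u v)
  then show ?case by (auto simp: image_subset_iff)
qed auto

lemma weyl_group_root:
  assumes "w \<in> weyl_group e n" "r \<in> roots e n"
  shows "w r \<in> roots e n"
proof -
  obtain i j where ij: "i \<in> indices" "j \<in> indices" "i \<noteq> j" "r = e i - e j"
    using assms(2) by (rule rootE)
  then obtain i' j' where ij': "i' \<in> indices" "j' \<in> indices" "w (e i) = e i'" "w (e j) = e j'"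
    using weyl_group_permutes_e[OF assms(1)] by blast
  moreover have "i' \<noteq> j'"
    using ij ij' e_eq_iff[of i j] reflection_group_bij[OF assms(1)] by (metis bij_is_inj injD)
  moreover have "w r = e i' - e j'"
    using ij ij' linear_diff[OF reflection_group_linear[OF assms(1)]] by simp
  ultimately show ?thesis by (auto simp: roots_eq)
qed

lemma weyl_group_eqI:
  assumes "u \<in> weyl_group e n" "v \<in> weyl_group e n" "\<And>i. i \<in> indices \<Longrightarrow> u (e i) = v (e i)"
  shows "u = v"
proof
  fix x
  show "u x = v x"
  proof (rule linear_eq_on_span[of u v "e ` indices"])
    show "linear u" "linear v"
      using assms by (auto intro: reflection_group_linear)
    show "x \<in> span (e ` indices)"
      by (simp add: span_e)
  qed (use assms(3) in auto)
qed

lemma finite_weyl_group: "finite (weyl_group e n)"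
proof (rule inj_on_finite)
  show "inj_on (\<lambda>w. restrict w (e ` indices)) (weyl_group e n)"
  proof (rule inj_onI)
    fix u v
    assume uv: "u \<in> weyl_group e n" "v \<in> weyl_group e n"
      and eq: "restrict u (e ` indices) = restrict v (e ` indices)"
    show "u = v"
      using uv
    proof (rule weyl_group_eqI)
      fix i assume "i \<in> indices"
      then show "u (e i) = v (e i)" using fun_cong[OF eq, of "e i"] by auto
    qed
  qed
  show "(\<lambda>w. restrict w (e ` indices)) ` weyl_group e n
      \<subseteq> (e ` indices) \<rightarrow>\<^sub>E (e ` indices)"
  proof (rule image_subsetI)
    fix w assume "w \<in> weyl_group e n"
    then have "w x \<in> e ` indices" if "x \<in> e ` indices" for x
      using weyl_group_permutes_e that by blast
    then show "restrict w (e ` indices) \<in> (e ` indices) \<rightarrow>\<^sub>E (e ` indices)"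
      by (rule restrict_PiE_iff[THEN iffD2, rule_format])
  qed
qed (auto intro: finite_PiE simp: finite_indices)

section \<open>Positivity under parabolic subgroups and under coset representatives\<close>

lemma parabolic_subset: "J \<subseteq> simple_roots e n \<Longrightarrow> parabolic J \<subseteq> weyl_group e n"
  using simple_subset_roots by (intro reflection_group_mono) auto

text \<open>\<open>v\<close> changes \<open>r\<close> only by a vector of span J, so it keeps the
  coefficients at simple roots outside J. One of these is 1 because \<open>r\<close> is not in span
  J, and a root with one positive coefficient is positive.\<close>

lemma parabolic_pos_outside_span:
  assumes "J \<subseteq> simple_roots e n" "v \<in> parabolic J" "r \<in> pos_roots e n" "r \<notin> span J"
  shows "v r \<in> pos_roots e n"
proof -
  obtain i j where ij: "i \<in> indices" "j \<in> indices" "i < j" "r = e i - e j"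
    using assms(3) by (rule pos_rootE)
  have "\<exists>k\<in>{i..<j}. e k - e (Suc k) \<notin> J"
  proof (rule ccontr)
    assume "\<not> ?thesis"
    then have "(\<Sum>k\<in>{i..<j}. e k - e (Suc k)) \<in> span J"
      by (intro span_sum span_base) auto
    then show False
      using assms(4) ij(4) root_telescope[OF less_imp_le[OF ij(3)]] by simp
  qed
  then obtain k where k: "k \<in> {i..<j}" "e k - e (Suc k) \<notin> J" by blast
  then have kn: "k \<in> {1..n}" using ij by (auto simp: indices_iff)
  have "(v r - r) \<bullet> omega k = 0"
    using assms kn k by (intro inner_omega_span[of J] reflection_group_moves_in_span) auto
  moreover have "r \<bullet> omega k = 1"
    using ij k kn by (simp add: inner_diff_left inner_e_omega)
  ultimately have "v r \<bullet> omega k > 0" by (simp add: inner_diff_left)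
  moreover have "v r \<in> roots e n"
    using assms(2,3) parabolic_subset[OF assms(1)]
      pos_roots_iff_rho weyl_group_root by blast
  ultimately show ?thesis using kn root_pos_iff_omega[of "v r" k] by auto
qed

text \<open>\<open>r\<close> is a sum of simple roots of \<open>J\<close>, as many as its height;
  \<open>d\<close> sends each of them to a positive root, whose height is at least 1.\<close>

lemma inner_rho_image_pos_root_ge:
  assumes J: "J \<subseteq> simple_roots e n" and d: "linear d" "d ` J \<subseteq> pos_roots e n"
    and r: "r \<in> pos_roots e n" "r \<in> span J"
  shows "d r \<bullet> rho \<ge> r \<bullet> rho"
proof -
  obtain i j where ij: "i \<in> indices" "j \<in> indices" "i < j" "r = e i - e j"
    using r(1) by (rule pos_rootE)
  have "d r = (\<Sum>k\<in>{i..<j}. d (e k - e (Suc k)))"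
    unfolding ij(4) by (subst root_telescope[OF less_imp_le[OF ij(3)]]) (rule linear_sum[OF d(1)])
  then have "d r \<bullet> rho = (\<Sum>k\<in>{i..<j}. d (e k - e (Suc k)) \<bullet> rho)"
    by (simp add: inner_sum_left)
  also have "\<dots> \<ge> (\<Sum>k\<in>{i..<j}. 1)"
  proof (rule sum_mono)
    fix k assume "k \<in> {i..<j}"
    then have "e k - e (Suc k) \<in> J"
      using simple_roots_of_pos_root_in_span J ij r by blast
    then show "1 \<le> d (e k - e (Suc k)) \<bullet> rho"
      using d(2) by (intro pos_root_inner_rho_ge_1) blast
  qed
  finally show ?thesis
    using ij(1-3) unfolding ij(4) by (simp add: inner_root_rho of_nat_diff)
qed

lemma coset_rep_pos:
  assumes "J \<subseteq> simple_roots e n" "d \<in> coset_reps e n J" "r \<in> pos_roots e n" "r \<in> span J"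
  shows "d r \<in> pos_roots e n"
proof -
  have d: "d \<in> weyl_group e n" "d ` J \<subseteq> pos_roots e n"
    using assms(2) by (auto simp: coset_reps_def)
  have "r \<bullet> rho \<le> d r \<bullet> rho"
    using assms d reflection_group_linear by (intro inner_rho_image_pos_root_ge[of J d r]) auto
  then show ?thesis
    using assms(3) d weyl_group_root[of d r] by (simp add: pos_roots_iff_rho)
qed

lemma coset_rep_pos_iff:
  assumes "J \<subseteq> simple_roots e n" "d \<in> coset_reps e n J" "r \<in> roots e n" "r \<in> span J"
  shows "d r \<in> pos_roots e n \<longleftrightarrow> r \<in> pos_roots e n"
proof
  assume pos: "d r \<in> pos_roots e n"
  show "r \<in> pos_roots e n"
  proof (rule ccontr)
    assume "r \<notin> pos_roots e n"
    then have "- r \<in> pos_roots e n" using assms(3) root_pos_or_neg by blast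
    then have "d (- r) \<in> pos_roots e n"
      using coset_rep_pos[OF assms(1,2)] span_neg[OF assms(4)] by blast
    moreover have "d (- r) = - d r"
      using assms(2) linear_neg[of d r] reflection_group_linear[of d "roots e n"]
      by (simp add: coset_reps_def)
    ultimately show False using pos pos_root_uminus_not_pos by auto
  qed
qed (rule coset_rep_pos[OF assms(1,2) _ assms(4)])

text \<open>Height forces this: \<open>r\<close> is positive because \<open>d r\<close> is, and its
  height cannot exceed that of \<open>d r\<close>, which is 1. So \<open>r\<close> is simple, and a
  simple root in span J belongs to J.\<close>

lemma coset_rep_simple_imp_simple:
  assumes "J \<subseteq> simple_roots e n" "d \<in> coset_reps e n J" "r \<in> roots e n" "r \<in> span J"
    "d r \<in> simple_roots e n"
  shows "r \<in> J"
proof -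
  have r: "r \<in> pos_roots e n"
    using coset_rep_pos_iff[OF assms(1-4)] assms(5) simple_subset_pos by blast
  then obtain i j where ij: "i \<in> indices" "j \<in> indices" "i < j" "r = e i - e j"
    by (rule pos_rootE)
  have "r \<bullet> rho \<le> 1"
    using inner_rho_image_pos_root_ge[of J d r] assms r simple_root_inner_rho[OF assms(5)]
      reflection_group_linear[of d "roots e n"]
    by (simp add: coset_reps_def)
  then have "j = Suc i" using ij by (auto simp: inner_root_rho)
  then show ?thesis
    using simple_roots_of_pos_root_in_span[of J i j i] assms ij by auto
qed

section \<open>Distinguished coset representatives\<close>

lemma coset_reps_iff: "d \<in> coset_reps e n J \<longleftrightarrow> d \<in> weyl_group e n \<and> (\<forall>s\<in>J. d s \<in> pos_roots e n)"
  by (auto simp: coset_reps_def)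

lemma coset_repsD: "d \<in> coset_reps e n J \<Longrightarrow> d \<in> weyl_group e n"
  by (simp add: coset_reps_def)

lemma finite_coset_reps: "finite (coset_reps e n J)"
  using finite_weyl_group by (auto simp: coset_reps_def)

lemma double_coset_reps_iff:
  "w \<in> double_coset_reps e n J K \<longleftrightarrow> w\<^sup>- \<in> coset_reps e n J \<and> w \<in> coset_reps e n K"
proof
  assume w: "w \<in> double_coset_reps e n J K"
  then obtain u where u: "u \<in> coset_reps e n J" "w = u\<^sup>-"
    by (auto simp: double_coset_reps_def)
  then have "w\<^sup>- = u"
    using reflection_group_inv_simps(3)[OF coset_repsD] by simp
  then show "w\<^sup>- \<in> coset_reps e n J \<and> w \<in> coset_reps e n K"
    using w u by (simp add: double_coset_reps_def)
next
  assume w: "w\<^sup>- \<in> coset_reps e n J \<and> w \<in> coset_reps e n K"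
  then have "w = (w\<^sup>-)\<^sup>-"
    using reflection_group_inv_simps(3)[of w "roots e n"] by (simp add: coset_reps_iff)
  then show "w \<in> double_coset_reps e n J K"
    using w by (auto simp: double_coset_reps_def)
qed

lemma finite_double_coset_reps: "finite (double_coset_reps e n J K)"
  using finite_coset_reps by (simp add: double_coset_reps_def)

lemma inv_double_coset_reps:
  assumes "w \<in> double_coset_reps e n J K"
  shows "w\<^sup>- \<in> double_coset_reps e n K J"
  using assms reflection_group_inv_simps(3)[of w "roots e n"]
  by (simp add: double_coset_reps_iff coset_reps_iff)

lemma double_coset_repsD: "w \<in> double_coset_reps e n J K \<Longrightarrow> w \<in> weyl_group e n"
  by (simp add: double_coset_reps_iff coset_reps_iff)

text \<open>Choose \<open>b\<close> to maximise \<open>h (b rho) \<bullet> rho\<close>: if \<open>h (b s)\<close> were negative on \<open>rho\<close>,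
  multiplying \<open>b\<close> by the reflection in \<open>s\<close> would increase it.\<close>

lemma exists_parabolic_nonneg:
  assumes J: "J \<subseteq> simple_roots e n" and h: "linear h"
  shows "\<exists>b\<in>parabolic J. \<forall>s\<in>J. 0 \<le> h (b s) \<bullet> rho"
proof -
  define f where "f b = h (b rho) \<bullet> rho" for b :: "'a \<Rightarrow> 'a"
  have fin: "finite (f ` parabolic J)"
    using finite_subset[OF parabolic_subset[OF J] finite_weyl_group] by simp
  have "f ` parabolic J \<noteq> {}"
    using id_in_reflection_group by blast
  then obtain b where b: "b \<in> parabolic J" "Max (f ` parabolic J) = f b"
    using Max_in[OF fin] by blast
  have "0 \<le> h (b s) \<bullet> rho" if s: "s \<in> J" for s
  proof -
    have "b \<circ> root_reflection s \<in> parabolic J"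
      using b s by (intro comp_in_reflection_group root_reflection_in_reflection_group)
    then have "f (b \<circ> root_reflection s) \<le> f b"
      using fin b(2) by (metis Max_ge imageI)
    moreover have "b (root_reflection s rho) = b rho - (2 / (s \<bullet> s)) *\<^sub>R b s"
      using simple_root_inner_rho[of s] s J reflection_group_linear[OF b(1)]
      by (auto simp: root_reflection_def linear_diff linear_scale inner_commute)
    ultimately have "0 \<le> (2 / (s \<bullet> s)) * (h (b s) \<bullet> rho)"
      by (simp add: f_def linear_diff[OF h] linear_scale[OF h] inner_diff_left)
    moreover have "0 < s \<bullet> s"
      using simple_root_inner_rho[of s] s J by auto
    ultimately show ?thesis
      by (simp add: zero_le_mult_iff zero_le_divide_iff)
  qed
  then show ?thesis using b(1) by blast
qed

text \<open>The maximising \<open>b\<close> for the linear map \<open>w\<close> makes every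
  \<open>w (b s)\<close> nonnegative on \<open>rho\<close>. A root is never 0 there, so
  \<open>w (b s)\<close> is positive and w b is the representative.\<close>

lemma parabolic_decomposition:
  assumes "J \<subseteq> simple_roots e n" "w \<in> weyl_group e n"
  obtains d v where "d \<in> coset_reps e n J" "v \<in> parabolic J" "w = d \<circ> v"
proof -
  obtain b where b: "b \<in> parabolic J" "\<forall>s\<in>J. 0 \<le> w (b s) \<bullet> rho"
    using exists_parabolic_nonneg[OF assms(1) reflection_group_linear[OF assms(2)]] by blast
  have bW: "b \<in> weyl_group e n" using b(1) parabolic_subset[OF assms(1)] by blast
  have "w \<circ> b \<in> coset_reps e n J"
    unfolding coset_reps_iff
  proof (intro conjI ballI)
    show "w \<circ> b \<in> weyl_group e n"
      using assms(2) bW by (rule comp_in_reflection_group)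
    fix s assume s: "s \<in> J"
    then have root: "w (b s) \<in> roots e n"
      using assms bW simple_subset_roots weyl_group_root by blast
    then show "(w \<circ> b) s \<in> pos_roots e n"
      using b(2) s root_inner_rho_nonzero[OF root] by (auto simp: pos_roots_iff_rho less_le)
  qed
  moreover have "b\<^sup>- \<in> parabolic J" using b(1) by (rule inv_in_reflection_group)
  moreover have "w = (w \<circ> b) \<circ> b\<^sup>-"
    using reflection_group_inv_simps(4)[OF b(1)] by (simp add: comp_assoc)
  ultimately show thesis by (rule that)
qed

text \<open>\<open>w\<close> permutes the e_i, and preserving positive roots makes the permutation
  of the indices increasing.\<close>

lemma pos_preserving_imp_id:
  assumes "w \<in> weyl_group e n" "w ` pos_roots e n \<subseteq> pos_roots e n"
  shows "w = id"
proof -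
  have "\<forall>i\<in>indices. \<exists>j\<in>indices. w (e i) = e j"
    using weyl_group_permutes_e[OF assms(1)] by blast
  then obtain f where f: "\<And>i. i \<in> indices \<Longrightarrow> f i \<in> indices" "\<And>i. i \<in> indices \<Longrightarrow> w (e i) = e (f i)"
    by metis
  have mono: "f i < f j" if ij: "i \<in> indices" "j \<in> indices" "i < j" for i j
  proof -
    have "e i - e j \<in> pos_roots e n"
      using ij by (auto simp: pos_roots_iff_rho roots_eq inner_root_rho)
    then have "w (e i - e j) \<in> pos_roots e n"
      using assms(2) by blast
    then have "e (f i) - e (f j) \<in> pos_roots e n"
      using f ij linear_diff[OF reflection_group_linear[OF assms(1)]] by simp
    then show ?thesis
      using f ij by (simp add: pos_roots_iff_rho inner_root_rho)
  qed
  have "f i = i" if "i \<in> indices" for i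
    using strict_mono_on_interval_eq[of "n + 1" f i] mono f(1) that
    unfolding indices_def by blast
  then show ?thesis
    using f(2) by (intro weyl_group_eqI[OF assms(1) id_in_reflection_group]) auto
qed

text \<open>As an element of W_J, \<open>v\<close> keeps the positive roots off span J positive; as
  an element of X_J, it does so for those in span J.\<close>

lemma parabolic_pos_preserving_imp_id:
  assumes J: "J \<subseteq> simple_roots e n" and v: "v \<in> parabolic J" and pos: "\<forall>s\<in>J. v s \<in> pos_roots e n"
  shows "v = id"
proof -
  have vW: "v \<in> weyl_group e n" using v parabolic_subset[OF J] by blast
  then have "v \<in> coset_reps e n J" using pos by (simp add: coset_reps_iff)
  then have "v r \<in> pos_roots e n" if "r \<in> pos_roots e n" for r
    using parabolic_pos_outside_span[OF J v that] coset_rep_pos[OF J _ that] by blast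
  then show ?thesis
    using vW by (intro pos_preserving_imp_id) auto
qed

lemma parabolic_decomposition_unique:
  assumes J: "J \<subseteq> simple_roots e n"
    and d: "d \<in> coset_reps e n J" "d' \<in> coset_reps e n J"
    and v: "v \<in> parabolic J" "v' \<in> parabolic J" and eq: "d \<circ> v = d' \<circ> v'"
  shows "d = d'" "v = v'"
proof -
  have W: "d \<in> weyl_group e n" "d' \<in> weyl_group e n"
    using d coset_repsD by auto
  \<comment> \<open>Then d = d' g with g in W_J. Since d' preserves signs of roots in span J,
    positivity of \<open>d s\<close> passes to \<open>g s\<close>, which forces g = id.\<close>
  define g where "g = v' \<circ> v\<^sup>-"
  have g: "g \<in> parabolic J"
    unfolding g_def using v by (intro comp_in_reflection_group inv_in_reflection_group)
  have dg: "d x = d' (g x)" for x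
    using fun_cong[OF eq, of "v\<^sup>- x"] reflection_group_inv_simps(1)[OF v(1)] by (simp add: g_def)
  have "\<forall>s\<in>J. g s \<in> pos_roots e n"
  proof
    fix s assume s: "s \<in> J"
    have "g s \<in> span J"
      using reflection_group_span_iff[OF g] s by (simp add: span_base)
    moreover have "g s \<in> roots e n"
      using g s J parabolic_subset[OF J] simple_subset_roots weyl_group_root by blast
    moreover have "d' (g s) \<in> pos_roots e n"
      using d(1) s by (simp add: coset_reps_iff flip: dg)
    ultimately show "g s \<in> pos_roots e n"
      using coset_rep_pos_iff[OF J d(2)] by blast
  qed
  then have "g = id"
    using parabolic_pos_preserving_imp_id[OF J g] by blast
  then show "d = d'" using dg by auto
  with eq show "v = v'"
    using reflection_group_inv_simps(2)[OF W(1)] by (metis comp_apply ext)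
qed

text \<open>Elements of K that d^-1 sends off span J give positive roots, and v^-1 in W_J keeps them
  positive. Those sent into span J land in J itself, because d returns them to simple roots; they
  make up the set on the right.\<close>

lemma double_coset_rep_mult:
  assumes K: "K \<subseteq> simple_roots e n" and J: "J \<subseteq> simple_roots e n"
    and d: "d \<in> double_coset_reps e n K J" and v: "v \<in> parabolic J"
  shows "(d \<circ> v)\<^sup>- \<in> coset_reps e n K \<longleftrightarrow> v\<^sup>- \<in> coset_reps e n (d\<^sup>- ` K \<inter> J)"
proof -
  have W: "d \<in> weyl_group e n" "v \<in> weyl_group e n"
    using d v double_coset_repsD parabolic_subset[OF J] by auto
  have inv: "(d \<circ> v)\<^sup>- = v\<^sup>- \<circ> d\<^sup>-"
    using W by (rule reflection_group_inv_comp)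
  have v': "v\<^sup>- \<in> parabolic J" using v by (rule inv_in_reflection_group)
  have dK: "d\<^sup>- \<in> coset_reps e n K" and dJ: "d \<in> coset_reps e n J"
    using d by (auto simp: double_coset_reps_iff)
  have "v\<^sup>- (d\<^sup>- k) \<in> pos_roots e n"
    if k: "k \<in> K" and pos: "\<forall>s \<in> d\<^sup>- ` K \<inter> J. v\<^sup>- s \<in> pos_roots e n" for k
  proof (cases "d\<^sup>- k \<in> span J")
    case True
    have "d (d\<^sup>- k) \<in> simple_roots e n"
      using k K reflection_group_inv_simps(1)[OF W(1)] by auto
    moreover have "d\<^sup>- k \<in> roots e n"
      using dK k by (auto simp: coset_reps_iff pos_roots_iff_rho)
    ultimately have "d\<^sup>- k \<in> J"
      using coset_rep_simple_imp_simple[OF J dJ] True by blast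
    then show ?thesis using k pos by blast
  next
    case False
    then show ?thesis
      using dK k by (intro parabolic_pos_outside_span[OF J v']) (auto simp: coset_reps_iff)
  qed
  then show ?thesis
    using W by (auto simp: inv coset_reps_iff intro!: comp_in_reflection_group inv_in_reflection_group)
qed

lemma double_coset_decomposition:
  assumes K: "K \<subseteq> simple_roots e n" and J: "J \<subseteq> simple_roots e n"
  shows "bij_betw (\<lambda>(d, v). d \<circ> v)
    (SIGMA d : double_coset_reps e n K J. {v \<in> parabolic J. v\<^sup>- \<in> coset_reps e n (d\<^sup>- ` K \<inter> J)})
    {w \<in> weyl_group e n. w\<^sup>- \<in> coset_reps e n K}" (is "bij_betw ?f ?A ?B")
  unfolding bij_betw_def
proof (intro conjI)
  show "inj_on ?f ?A"
  proof (rule inj_onI, clarify)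
    fix d v d' v'
    assume "d \<in> double_coset_reps e n K J" "d' \<in> double_coset_reps e n K J"
      "v \<in> parabolic J" "v' \<in> parabolic J" "d \<circ> v = d' \<circ> v'"
    then show "d = d' \<and> v = v'"
      using parabolic_decomposition_unique[OF J, of d d' v v'] by (simp add: double_coset_reps_iff)
  qed
  show "?f ` ?A = ?B"
  proof (intro equalityI subsetI)
    fix w assume "w \<in> ?f ` ?A"
    then obtain d v where dv: "d \<in> double_coset_reps e n K J" "v \<in> parabolic J"
      "v\<^sup>- \<in> coset_reps e n (d\<^sup>- ` K \<inter> J)" "w = d \<circ> v"
      by auto
    then show "w \<in> ?B"
      using double_coset_rep_mult[OF K J dv(1,2)] double_coset_repsD[OF dv(1)] parabolic_subset[OF J]
        comp_in_reflection_group[of d "roots e n" v] by auto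
  next
    fix w assume "w \<in> ?B"
    then have w: "w \<in> weyl_group e n" "w\<^sup>- \<in> coset_reps e n K" by auto
    obtain d v where dv: "d \<in> coset_reps e n J" "v \<in> parabolic J" "w = d \<circ> v"
      using parabolic_decomposition[OF J w(1)] by blast
    have W: "d \<in> weyl_group e n" "v \<in> weyl_group e n"
      using dv coset_repsD parabolic_subset[OF J] by auto
    \<comment> \<open>That d^-1 lies in X_K is inherited from w. Here d^-1 k is the image under v of
      the positive root w^-1 k: off span J, v keeps it positive; in span J, d^-1 k has the sign of
      its image k under d.\<close>
    have "d\<^sup>- k \<in> pos_roots e n" if k: "k \<in> K" for k
    proof -
      have root: "d\<^sup>- k \<in> roots e n"
        using k K simple_subset_roots W inv_in_reflection_group weyl_group_root by blast
      have wk: "w\<^sup>- k \<in> pos_roots e n"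
        using w k by (simp add: coset_reps_iff)
      have vw: "d\<^sup>- k = v (w\<^sup>- k)"
        using reflection_group_inv_comp[OF W] reflection_group_inv_simps(1)[OF W(2)] dv(3) by simp
      show ?thesis
      proof (cases "w\<^sup>- k \<in> span J")
        case True
        then have "d\<^sup>- k \<in> span J"
          using reflection_group_span_iff[OF dv(2)] vw by simp
        moreover have "d (d\<^sup>- k) \<in> pos_roots e n"
          using k K simple_subset_pos reflection_group_inv_simps(1)[OF W(1)] by auto
        ultimately show ?thesis
          using coset_rep_pos_iff[OF J dv(1) root] by blast
      next
        case False
        then show ?thesis
          unfolding vw by (intro parabolic_pos_outside_span[OF J dv(2) wk])
      qed
    qed
    then have d: "d \<in> double_coset_reps e n K J"
      using dv(1) W inv_in_reflection_group by (auto simp: double_coset_reps_iff coset_reps_iff)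
    then have "v\<^sup>- \<in> coset_reps e n (d\<^sup>- ` K \<inter> J)"
      using double_coset_rep_mult[OF K J d dv(2)] w(2) dv(3) by simp
    then show "w \<in> ?f ` ?A" using d dv by auto
  qed
qed

section \<open>Structure constants and products in the group algebra\<close>

text \<open>For s in \<open>N\<close>, the root \<open>v s\<close> stays in span J, where
  \<open>d\<close> preserves signs.\<close>

lemma coset_rep_mult:
  assumes J: "J \<subseteq> simple_roots e n" and d: "d \<in> coset_reps e n J" and v: "v \<in> parabolic J"
    and N: "N \<subseteq> J"
  shows "d \<circ> v \<in> coset_reps e n N \<longleftrightarrow> v \<in> coset_reps e n N"
proof -
  have W: "d \<in> weyl_group e n" "v \<in> weyl_group e n"
    using d v coset_repsD parabolic_subset[OF J] by auto
  have "d (v s) \<in> pos_roots e n \<longleftrightarrow> v s \<in> pos_roots e n" if s: "s \<in> N" for s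
  proof (rule coset_rep_pos_iff[OF J d])
    have "s \<in> roots e n" using s N J simple_subset_roots by blast
    then show "v s \<in> roots e n" using W weyl_group_root by blast
    show "v s \<in> span J"
      using reflection_group_span_iff[OF v] s N by (blast intro: span_base)
  qed
  then show ?thesis
    using W comp_in_reflection_group[OF W] by (auto simp: coset_reps_iff)
qed

text \<open>Only the inclusion from left to right has content: if v^-1 sends d^-1 k into N, then
  d^-1 k lies in span J, and since d maps it to the simple root k it lies in J.\<close>

lemma double_coset_rep_mult_Int:
  assumes K: "K \<subseteq> simple_roots e n" and J: "J \<subseteq> simple_roots e n"
    and d: "d \<in> double_coset_reps e n K J" and v: "v \<in> parabolic J" and N: "N \<subseteq> J"
  shows "(d \<circ> v)\<^sup>- ` K \<inter> N = v\<^sup>- ` (d\<^sup>- ` K \<inter> J) \<inter> N"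
proof -
  have W: "d \<in> weyl_group e n" "v \<in> weyl_group e n"
    using d v double_coset_repsD parabolic_subset[OF J] by auto
  have inv: "(d \<circ> v)\<^sup>- = v\<^sup>- \<circ> d\<^sup>-"
    using W by (rule reflection_group_inv_comp)
  have "d\<^sup>- k \<in> J" if k: "k \<in> K" and vk: "v\<^sup>- (d\<^sup>- k) \<in> N" for k
  proof (rule coset_rep_simple_imp_simple[OF J])
    show "d \<in> coset_reps e n J" using d by (simp add: double_coset_reps_iff)
    show "d\<^sup>- k \<in> roots e n"
      using d k by (simp add: double_coset_reps_iff coset_reps_iff pos_roots_iff_rho)
    show "d\<^sup>- k \<in> span J"
      using reflection_group_span_iff[OF inv_in_reflection_group[OF v]] vk N
      by (blast intro: span_base)
    show "d (d\<^sup>- k) \<in> simple_roots e n"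
      using k K reflection_group_inv_simps(1)[OF W(1)] by auto
  qed
  then show ?thesis by (auto simp: inv)
qed

text \<open>Once \<open>M d\<close> is known, the two conditions on w = d v counted by the left side
  become conditions on v alone, by \<open>coset_rep_mult\<close> and
  \<open>double_coset_rep_mult_Int\<close>.\<close>

lemma struct_const_parabolic:
  assumes K: "K \<subseteq> simple_roots e n" and J: "J \<subseteq> simple_roots e n" and N: "N \<subseteq> J"
  shows "struct_const e n K N P
    = (\<Sum>M\<in>Pow J. struct_const e n K J M * struct_const_rel e n J M N P)"
proof -
  define M where "M d = d\<^sup>- ` K \<inter> J" for d :: "'a \<Rightarrow> 'a"
  define S where "S d = {v \<in> parabolic J \<inter> double_coset_reps e n (M d) N. v\<^sup>- ` M d \<inter> N = P}" for d
  let ?A = "SIGMA d : double_coset_reps e n K J. {v \<in> parabolic J. v\<^sup>- \<in> coset_reps e n (M d)}"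
  let ?B = "{w \<in> weyl_group e n. w\<^sup>- \<in> coset_reps e n K}"
  have bij: "bij_betw (\<lambda>(d, v). d \<circ> v)
      {x \<in> ?A. case x of (d, v) \<Rightarrow> v \<in> coset_reps e n N \<and> v\<^sup>- ` M d \<inter> N = P}
      {w \<in> ?B. w \<in> coset_reps e n N \<and> w\<^sup>- ` K \<inter> N = P}"
  proof (rule bij_betw_Collect)
    show "bij_betw (\<lambda>(d, v). d \<circ> v) ?A ?B"
      unfolding M_def by (rule double_coset_decomposition[OF K J])
    fix x assume "x \<in> ?A"
    then obtain d v where x: "x = (d, v)" "d \<in> double_coset_reps e n K J" "v \<in> parabolic J"
      by auto
    have "d \<circ> v \<in> coset_reps e n N \<longleftrightarrow> v \<in> coset_reps e n N"
      using x by (intro coset_rep_mult[OF J _ _ N]) (auto simp: double_coset_reps_iff)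
    then show "((case x of (d, v) \<Rightarrow> d \<circ> v) \<in> coset_reps e n N
          \<and> (case x of (d, v) \<Rightarrow> d \<circ> v)\<^sup>- ` K \<inter> N = P)
        \<longleftrightarrow> (case x of (d, v) \<Rightarrow> v \<in> coset_reps e n N \<and> v\<^sup>- ` M d \<inter> N = P)"
      using double_coset_rep_mult_Int[OF K J x(2,3) N] by (simp add: x(1) M_def)
  qed
  have A: "{x \<in> ?A. case x of (d, v) \<Rightarrow> v \<in> coset_reps e n N \<and> v\<^sup>- ` M d \<inter> N = P}
      = (SIGMA d : double_coset_reps e n K J. S d)"
    by (auto simp: S_def double_coset_reps_iff)
  have B: "{w \<in> ?B. w \<in> coset_reps e n N \<and> w\<^sup>- ` K \<inter> N = P}
      = {w \<in> double_coset_reps e n K N. w\<^sup>- ` K \<inter> N = P}"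
    by (auto simp: double_coset_reps_iff coset_reps_iff)
  have "struct_const e n K N P = card (SIGMA d : double_coset_reps e n K J. S d)"
    unfolding struct_const_def using bij_betw_same_card[OF bij] by (simp only: A B)
  also have "\<dots> = (\<Sum>d\<in>double_coset_reps e n K J. card (S d))"
    using finite_double_coset_reps by (intro card_SigmaI) (auto simp: S_def)
  \<comment> \<open>The size of \<open>S d\<close> depends on d only through \<open>M d\<close>.
    Collecting the d with \<open>M d = L\<close>, of which there are
    \<open>struct_const e n K J L\<close>, turns the sum into products.\<close>
  also have "\<dots> = (\<Sum>L\<in>Pow J. \<Sum>d\<in>{d \<in> double_coset_reps e n K J. M d = L}. card (S d))"
    using finite_double_coset_reps finite_subset[OF J finite_simple_roots]
    by (intro sum.group[symmetric]) (auto simp: M_def)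
  also have "\<dots> = (\<Sum>L\<in>Pow J. struct_const e n K J L * struct_const_rel e n J L N P)"
    by (intro sum.cong refl) (simp add: struct_const_def struct_const_rel_def S_def flip: M_def)
  finally show ?thesis .
qed

section \<open>Solomon's formula for products in the group algebra\<close>

lemma lookup_x_elem:
  "Poly_Mapping.lookup (x_elem e n J) w = (if w \<in> coset_reps e n J then 1 else 0)"
  using finite_coset_reps[of J]
  by (simp add: x_elem_def lookup_sum lookup_single when_def)

lemma keys_x_elem: "Poly_Mapping.keys (x_elem e n J) = coset_reps e n J"
  by (auto simp: in_keys_iff lookup_x_elem split: if_splits)

lemma lookup_mult_x_elem:
  "Poly_Mapping.lookup (group_alg_mult (x_elem e n K) (x_elem e n N)) g
    = of_nat (card {(u, v). u \<in> coset_reps e n K \<and> v \<in> coset_reps e n N \<and> u \<circ> v = g})"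
proof -
  let ?A = "coset_reps e n K \<times> coset_reps e n N"
  have "Poly_Mapping.lookup (group_alg_mult (x_elem e n K) (x_elem e n N)) g
      = (\<Sum>u\<in>coset_reps e n K. \<Sum>v\<in>coset_reps e n N. if u \<circ> v = g then 1 else 0)"
    unfolding group_alg_mult_def keys_x_elem lookup_sum
    by (intro sum.cong refl) (simp add: lookup_x_elem lookup_single when_def)
  also have "\<dots> = (\<Sum>(u, v)\<in>?A. if u \<circ> v = g then 1 else 0)"
    by (rule sum.cartesian_product)
  also have "\<dots> = (\<Sum>x\<in>{x \<in> ?A. case x of (u, v) \<Rightarrow> u \<circ> v = g}. 1)"
    using finite_coset_reps
    by (subst sum.inter_filter) (auto intro!: sum.cong finite_cartesian_product)
  also have "{x \<in> ?A. case x of (u, v) \<Rightarrow> u \<circ> v = g}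
      = {(u, v). u \<in> coset_reps e n K \<and> v \<in> coset_reps e n N \<and> u \<circ> v = g}"
    by auto
  finally show ?thesis by simp
qed

text \<open>A factorization of g is determined by w = v^-1, subject to w^-1 in X_N and g w in X_K.
  Write w = d b by \<open>double_coset_decomposition\<close> for N and K. Each d admits exactly one
  b in W_K with g d b in X_K, so only the d are left to count; passing to d^-1 gives representatives
  for K and N.\<close>

lemma card_factorizations:
  assumes K: "K \<subseteq> simple_roots e n" and N: "N \<subseteq> simple_roots e n" and g: "g \<in> weyl_group e n"
  shows "card {(u, v). u \<in> coset_reps e n K \<and> v \<in> coset_reps e n N \<and> u \<circ> v = g}
    = card {w \<in> double_coset_reps e n K N. g \<in> coset_reps e n (w\<^sup>- ` K \<inter> N)}"
    (is "card ?P = card ?Q")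
proof -
  let ?M = "\<lambda>d. d\<^sup>- ` N \<inter> K"
  let ?A = "SIGMA d : double_coset_reps e n N K. {b \<in> parabolic K. b\<^sup>- \<in> coset_reps e n (?M d)}"
  let ?B = "{w \<in> weyl_group e n. w\<^sup>- \<in> coset_reps e n N}"
  let ?S = "{x \<in> ?A. case x of (d, b) \<Rightarrow> g \<circ> (d \<circ> b) \<in> coset_reps e n K}"
  let ?D = "{d \<in> double_coset_reps e n N K. g \<circ> d \<in> coset_reps e n (?M d)}"
  have "bij_betw (\<lambda>(d, b). d \<circ> b) ?S {w \<in> ?B. g \<circ> w \<in> coset_reps e n K}"
    by (rule bij_betw_Collect[OF double_coset_decomposition[OF N K]]) auto
  then have "card ?S = card {w \<in> ?B. g \<circ> w \<in> coset_reps e n K}"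
    by (rule bij_betw_same_card)
  also have "\<dots> = card ?P"
  proof (rule bij_betw_same_card, rule bij_betw_byWitness)
    show "\<forall>w\<in>{w \<in> ?B. g \<circ> w \<in> coset_reps e n K}. (snd (g \<circ> w, w\<^sup>-))\<^sup>- = w"
      by (auto simp: reflection_group_inv_simps(3))
    have P: "v \<in> weyl_group e n" "g \<circ> v\<^sup>- = u" if "(u, v) \<in> ?P" for u v
    proof -
      show v: "v \<in> weyl_group e n" using that coset_repsD by blast
      have "g = u \<circ> v" using that by simp
      then show "g \<circ> v\<^sup>- = u"
        using reflection_group_inv_simps(4)[OF v] by (simp add: comp_assoc)
    qed
    show "\<forall>x\<in>?P. (g \<circ> (snd x)\<^sup>-, ((snd x)\<^sup>-)\<^sup>-) = x"
    proof
      fix x assume "x \<in> ?P"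
      then show "(g \<circ> (snd x)\<^sup>-, ((snd x)\<^sup>-)\<^sup>-) = x"
        using P[of "fst x" "snd x"] reflection_group_inv_simps(3)[of "snd x"] by (cases x) simp
    qed
    show "(\<lambda>w. (g \<circ> w, w\<^sup>-)) ` {w \<in> ?B. g \<circ> w \<in> coset_reps e n K} \<subseteq> ?P"
    proof (rule image_subsetI)
      fix w assume w: "w \<in> {w \<in> ?B. g \<circ> w \<in> coset_reps e n K}"
      then have "g \<circ> w \<circ> w\<^sup>- = g"
        using reflection_group_inv_simps(4)[of w "roots e n"] by (simp add: comp_assoc)
      with w show "(g \<circ> w, w\<^sup>-) \<in> ?P" by simp
    qed
    show "(\<lambda>x. (snd x)\<^sup>-) ` ?P \<subseteq> {w \<in> ?B. g \<circ> w \<in> coset_reps e n K}"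
    proof (rule image_subsetI)
      fix x assume x: "x \<in> ?P"
      obtain u v where uv: "x = (u, v)" by fastforce
      then have "v \<in> weyl_group e n" "g \<circ> v\<^sup>- = u" "u \<in> coset_reps e n K" "v \<in> coset_reps e n N"
        using P x by auto
      then show "(snd x)\<^sup>- \<in> {w \<in> ?B. g \<circ> w \<in> coset_reps e n K}"
        using reflection_group_inv_simps(3)[of v "roots e n"] inv_in_reflection_group[of v "roots e n"]
        by (simp add: uv)
    qed
  qed
  finally have "card ?P = card ?S" by simp
  also have "\<dots> = card ?D"
  proof (rule bij_betw_same_card)
    have split: "g \<circ> d = (g \<circ> (d \<circ> b)) \<circ> b\<^sup>-" if "b \<in> parabolic K" for d b
      using reflection_group_inv_simps(4)[OF that] by (simp add: comp_assoc)
    \<comment> \<open>g d is g d b, an element of X_K, followed by b^-1 in W_K. So the condition on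
      b from the double coset decomposition is really one on g d, and b drops out of the
      count.\<close>
    have iff: "g \<circ> d \<in> coset_reps e n (?M d) \<longleftrightarrow> b\<^sup>- \<in> coset_reps e n (?M d)"
      if "b \<in> parabolic K" "g \<circ> (d \<circ> b) \<in> coset_reps e n K" for d b
      using coset_rep_mult[OF K that(2) inv_in_reflection_group[OF that(1)], of "?M d"]
      by (simp flip: split[OF that(1)])
    show "bij_betw fst ?S ?D"
      unfolding bij_betw_def
    proof (intro conjI)
      show "inj_on fst ?S"
      proof (rule inj_onI)
        fix x y assume xy: "x \<in> ?S" "y \<in> ?S" "fst x = fst y"
        obtain d b b' where x: "x = (d, b)" and y: "y = (d, b')"
          using xy(3) by (cases x; cases y) simp
        have b: "b \<in> parabolic K" "b' \<in> parabolic K"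
          and gdb: "g \<circ> (d \<circ> b) \<in> coset_reps e n K" "g \<circ> (d \<circ> b') \<in> coset_reps e n K"
          using xy(1,2) unfolding x y by blast+
        have "b\<^sup>- = b'\<^sup>-"
        proof (rule parabolic_decomposition_unique(2)[OF K gdb])
          show "b\<^sup>- \<in> parabolic K" "b'\<^sup>- \<in> parabolic K"
            using b by (auto intro: inv_in_reflection_group)
          show "g \<circ> (d \<circ> b) \<circ> b\<^sup>- = g \<circ> (d \<circ> b') \<circ> b'\<^sup>-"
            by (simp flip: split[OF b(1), of d] split[OF b(2), of d])
        qed
        then have "b = b'"
          using reflection_group_inv_simps(3)[OF b(1)] reflection_group_inv_simps(3)[OF b(2)] by metis
        then show "x = y" by (simp add: x y)
      qed
      show "fst ` ?S = ?D"
      proof (intro equalityI subsetI)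
        fix d assume "d \<in> fst ` ?S"
        then obtain b where "(d, b) \<in> ?S" by auto
        then show "d \<in> ?D" using iff[of b d] by simp
      next
        fix d assume d: "d \<in> ?D"
        then have "g \<circ> d \<in> weyl_group e n"
          using coset_repsD by blast
        then obtain c a where ca: "c \<in> coset_reps e n K" "a \<in> parabolic K" "g \<circ> d = c \<circ> a"
          using parabolic_decomposition[OF K] by blast
        have a: "a\<^sup>- \<in> parabolic K" using ca(2) by (rule inv_in_reflection_group)
        have "g \<circ> (d \<circ> a\<^sup>-) = c"
          using ca(3) reflection_group_inv_simps(4)[OF ca(2)] by (metis comp_assoc comp_id)
        then have "(d, a\<^sup>-) \<in> ?S"
          using d a ca(1) iff[OF a, of d] by simp
        then show "d \<in> fst ` ?S" by (rule image_eqI[rotated]) simp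
      qed
    qed
  qed
  also have "\<dots> = card ?Q"
  proof (rule bij_betw_same_card,
      rule bij_betw_byWitness[where f = "\<lambda>d. d\<^sup>-" and f' = "\<lambda>w. w\<^sup>-"])
    \<comment> \<open>Testing g d on the roots of \<open>?M d\<close> is testing g on their images
      under d, and these form the intersection of d(K) with N.\<close>
    have iff: "g \<circ> d \<in> coset_reps e n (?M d) \<longleftrightarrow> g \<in> coset_reps e n (d ` K \<inter> N)"
      if d: "d \<in> weyl_group e n" for d
    proof -
      have "x \<in> d\<^sup>- ` N \<longleftrightarrow> d x \<in> N" for x
        using reflection_group_inv_simps(1,2)[OF d] by (metis image_iff)
      then have "(\<forall>s \<in> d\<^sup>- ` N \<inter> K. P (d s)) \<longleftrightarrow> (\<forall>s \<in> d ` K \<inter> N. P s)" for P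
        by blast
      then show ?thesis
        using g comp_in_reflection_group[OF g d] by (simp add: coset_reps_iff)
    qed
    have inv: "(d\<^sup>-)\<^sup>- = d" if "d \<in> double_coset_reps e n I J" for d I J
      using reflection_group_inv_simps(3)[OF double_coset_repsD[OF that]] .
    show "\<forall>d\<in>?D. (d\<^sup>-)\<^sup>- = d"
      using inv[of _ N K] by simp
    show "\<forall>w\<in>?Q. (w\<^sup>-)\<^sup>- = w"
      using inv[of _ K N] by simp
    show "(\<lambda>d. d\<^sup>-) ` ?D \<subseteq> ?Q"
    proof (rule image_subsetI)
      fix d assume "d \<in> ?D"
      then show "d\<^sup>- \<in> ?Q"
        using inv[of d N K] inv_double_coset_reps[of d N K] iff[of d] double_coset_repsD[of d N K]
        by simp
    qed
    show "(\<lambda>w. w\<^sup>-) ` ?Q \<subseteq> ?D"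
    proof (rule image_subsetI)
      fix w assume "w \<in> ?Q"
      then show "w\<^sup>- \<in> ?D"
        using inv_double_coset_reps[of w K N] iff[of "w\<^sup>-"] double_coset_repsD[of "w\<^sup>-" N K]
        by simp
    qed
  qed
  finally show ?thesis .
qed

lemma mult_x_elem:
  assumes K: "K \<subseteq> simple_roots e n" and N: "N \<subseteq> simple_roots e n"
  shows "group_alg_mult (x_elem e n K) (x_elem e n N)
    = (\<Sum>w\<in>double_coset_reps e n K N. x_elem e n (w\<^sup>- ` K \<inter> N))"
proof (rule poly_mapping_eqI)
  fix g
  have "card {(u, v). u \<in> coset_reps e n K \<and> v \<in> coset_reps e n N \<and> u \<circ> v = g}
    = card {w \<in> double_coset_reps e n K N. g \<in> coset_reps e n (w\<^sup>- ` K \<inter> N)}"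
  proof (cases "g \<in> weyl_group e n")
    case True
    then show ?thesis by (rule card_factorizations[OF K N])
  next
    case False
    then have "{w \<in> double_coset_reps e n K N. g \<in> coset_reps e n (w\<^sup>- ` K \<inter> N)} = {}"
      using coset_repsD by blast
    moreover have "u \<circ> v \<noteq> g" if "u \<in> coset_reps e n K" "v \<in> coset_reps e n N" for u v
      using comp_in_reflection_group[OF that[THEN coset_repsD]] False by metis
    then have "{(u, v). u \<in> coset_reps e n K \<and> v \<in> coset_reps e n N \<and> u \<circ> v = g} = {}"
      by blast
    ultimately show ?thesis by (simp only: card.empty)
  qed
  moreover have "Poly_Mapping.lookup (\<Sum>w\<in>double_coset_reps e n K N. x_elem e n (w\<^sup>- ` K \<inter> N)) g
      = of_nat (card {w \<in> double_coset_reps e n K N. g \<in> coset_reps e n (w\<^sup>- ` K \<inter> N)})"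
    by (simp add: lookup_sum lookup_x_elem finite_double_coset_reps
        flip: sum.inter_filter)
  ultimately show "Poly_Mapping.lookup (group_alg_mult (x_elem e n K) (x_elem e n N)) g
      = Poly_Mapping.lookup (\<Sum>w\<in>double_coset_reps e n K N. x_elem e n (w\<^sup>- ` K \<inter> N)) g"
    by (simp only: lookup_mult_x_elem)
qed

section \<open>Linear independence\<close>

text \<open>The longest element of the parabolic subgroup of the complement of \<open>D\<close> does
  it. It arises as the maximiser for negation: simple roots outside \<open>D\<close> get height at
  most 0, and those in \<open>D\<close> lie off the span of the complement, so they stay
  positive.\<close>

lemma exists_positivity_pattern:
  assumes D: "D \<subseteq> simple_roots e n"
  obtains w where "w \<in> weyl_group e n" "{s \<in> simple_roots e n. w s \<in> pos_roots e n} = D"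
proof -
  let ?J = "simple_roots e n - D"
  have J: "?J \<subseteq> simple_roots e n" by blast
  have "linear (uminus :: 'a \<Rightarrow> 'a)"
    using linear_compose_neg[OF linear_id] by (simp add: id_def)
  from exists_parabolic_nonneg[OF J this] obtain b
    where b: "b \<in> parabolic ?J" "\<And>s. s \<in> ?J \<Longrightarrow> 0 \<le> - b s \<bullet> rho"
    by blast
  have "b s \<in> pos_roots e n \<longleftrightarrow> s \<in> D" if s: "s \<in> simple_roots e n" for s
  proof
    assume "b s \<in> pos_roots e n"
    then have "b s \<bullet> rho > 0" by (simp add: pos_roots_iff_rho)
    then show "s \<in> D" using b(2)[of s] s by force
  next
    assume "s \<in> D"
    obtain k where k: "k \<in> {1..n}" "s = e k - e (k + 1)"
      using s by (rule simple_rootE) auto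
    have "s \<notin> span ?J"
    proof
      assume "s \<in> span ?J"
      then have "s \<bullet> omega k = 0"
        using k \<open>s \<in> D\<close> by (intro inner_omega_span[OF J, of k]) auto
      then show False
        using k by (simp add: inner_diff_left inner_e_omega indices_iff)
    qed
    then show "b s \<in> pos_roots e n"
      using parabolic_pos_outside_span[OF J b(1)] s simple_subset_pos by blast
  qed
  then have "{s \<in> simple_roots e n. b s \<in> pos_roots e n} = D"
    using D by blast
  moreover have "b \<in> weyl_group e n"
    using b(1) parabolic_subset[OF J] by blast
  ultimately show thesis using that by blast
qed

lemma exists_coset_rep_only:
  assumes "D \<subseteq> simple_roots e n"
  obtains w where "\<And>L. L \<subseteq> simple_roots e n \<Longrightarrow> w \<in> coset_reps e n L \<longleftrightarrow> L \<subseteq> D"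
proof -
  obtain w where w: "w \<in> weyl_group e n" "{s \<in> simple_roots e n. w s \<in> pos_roots e n} = D"
    using exists_positivity_pattern[OF assms] by blast
  have "w \<in> coset_reps e n L \<longleftrightarrow> L \<subseteq> D" if "L \<subseteq> simple_roots e n" for L
    using w that unfolding coset_reps_iff by blast
  then show thesis by (rule that)
qed

text \<open>\<open>bracket\<close> labels coordinates by x_J rather than by J, so distinct subsets
  must give distinct labels. The element attached to L lies in X_L, hence in X_I when the two sums
  agree, which forces I into L.\<close>

lemma inj_on_x_elem: "inj_on (x_elem e n) (Pow (simple_roots e n))"
proof (rule inj_onI)
  have sub: "I \<subseteq> L" if IL: "I \<subseteq> simple_roots e n" "L \<subseteq> simple_roots e n"
    and eq: "x_elem e n I = x_elem e n L" for I L
  proof -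
    obtain w where w: "\<And>L'. L' \<subseteq> simple_roots e n \<Longrightarrow> w \<in> coset_reps e n L' \<longleftrightarrow> L' \<subseteq> L"
      using exists_coset_rep_only[OF IL(2)] by blast
    have "coset_reps e n I = coset_reps e n L"
      using eq by (simp flip: keys_x_elem)
    then show ?thesis using w[OF IL(1)] w[OF IL(2)] by blast
  qed
  fix I L assume "I \<in> Pow (simple_roots e n)" "L \<in> Pow (simple_roots e n)"
    "x_elem e n I = x_elem e n L"
  then show "I = L" using sub[of I L] sub[of L I] by auto
qed

text \<open>The x_L are triangular for inclusion: the element w attached to D lies in X_L exactly
  when L is contained in D. Reading a relation at w gives the sum of the coefficients over subsets
  of D, and induction leaves only that of D.\<close>

lemma independent_x_elem: "qvec.independent (x_elem e n ` Pow (simple_roots e n))"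
proof (rule qvec.independent_if_scalars_zero)
  show "finite (x_elem e n ` Pow (simple_roots e n))"
    using finite_simple_roots by simp
  fix f x
  assume eq: "(\<Sum>x\<in>x_elem e n ` Pow (simple_roots e n). qscale (f x) x) = 0"
    and x: "x \<in> x_elem e n ` Pow (simple_roots e n)"
  have zero: "(\<Sum>L\<in>Pow (simple_roots e n). qscale (f (x_elem e n L)) (x_elem e n L)) = 0"
    using eq by (simp add: sum.reindex[OF inj_on_x_elem])
  have f0: "f (x_elem e n D) = 0" if "D \<subseteq> simple_roots e n" for D
    using finite_subset[OF that finite_simple_roots] that
  proof (induction D rule: finite_psubset_induct)
    case (psubset D)
    obtain w where w: "\<And>L. L \<subseteq> simple_roots e n \<Longrightarrow> w \<in> coset_reps e n L \<longleftrightarrow> L \<subseteq> D"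
      using exists_coset_rep_only[OF psubset.prems] by blast
    have "0 = Poly_Mapping.lookup
        (\<Sum>L\<in>Pow (simple_roots e n). qscale (f (x_elem e n L)) (x_elem e n L)) w"
      by (simp add: zero)
    also have "\<dots> = (\<Sum>L\<in>Pow (simple_roots e n). if L = D then f (x_elem e n L) else 0)"
      unfolding lookup_sum
    proof (intro sum.cong refl)
      fix L assume "L \<in> Pow (simple_roots e n)"
      then show "Poly_Mapping.lookup (qscale (f (x_elem e n L)) (x_elem e n L)) w
          = (if L = D then f (x_elem e n L) else 0)"
        using w[of L] psubset.IH[of L] by (auto simp: lookup_x_elem)
    qed
    also have "\<dots> = f (x_elem e n D)"
      using psubset.prems finite_simple_roots by simp
    finally show ?case by simp
  qed
  then show "f x = 0" using x by auto
qed

lemma representation_x_elem: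
  assumes "L \<subseteq> simple_roots e n" "I \<subseteq> simple_roots e n"
  shows "qvec.representation (x_elem e n ` Pow (simple_roots e n)) (x_elem e n L) (x_elem e n I)
    = (if I = L then 1 else 0)"
  using qvec.representation_basis[OF independent_x_elem, of "x_elem e n L"] assms
    inj_on_eq_iff[OF inj_on_x_elem, of I L] by auto

text \<open>The sets \<open>L w\<close> may repeat: the coordinate at I is the number of w with
  \<open>L w = I\<close>, and swapping the two sums recovers the sum over w.\<close>

lemma bracket_sum_x_elem:
  assumes "\<And>w. w \<in> A \<Longrightarrow> L w \<subseteq> simple_roots e n"
  shows "bracket e n (\<Sum>w\<in>A. x_elem e n (L w)) = (\<Sum>w\<in>A. basis_class e n (L w))"
proof -
  let ?B = "x_elem e n ` Pow (simple_roots e n)"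
  have rep: "qvec.representation ?B (\<Sum>w\<in>A. x_elem e n (L w)) (x_elem e n I)
      = (\<Sum>w\<in>A. if I = L w then 1 else 0)" if I: "I \<subseteq> simple_roots e n" for I
  proof -
    have "x_elem e n (L w) \<in> qvec.span ?B" if "w \<in> A" for w
      using assms[OF that] by (intro qvec.span_base) blast
    then have "qvec.representation ?B (\<Sum>w\<in>A. x_elem e n (L w))
        = (\<lambda>b. \<Sum>w\<in>A. qvec.representation ?B (x_elem e n (L w)) b)"
      by (rule qvec.representation_sum[OF independent_x_elem])
    then show ?thesis
      using assms I by (simp add: representation_x_elem)
  qed
  have "bracket e n (\<Sum>w\<in>A. x_elem e n (L w))
      = (\<Sum>I\<in>Pow (simple_roots e n). \<Sum>w\<in>A. if I = L w then basis_class e n I else 0)"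
    unfolding bracket_def
  proof (intro sum.cong refl)
    fix I assume "I \<in> Pow (simple_roots e n)"
    then have "qscale (qvec.representation ?B (\<Sum>w\<in>A. x_elem e n (L w)) (x_elem e n I))
        (basis_class e n I) = (\<Sum>w\<in>A. qscale (if I = L w then 1 else 0) (basis_class e n I))"
      by (simp add: rep qvec.scale_sum_left)
    also have "\<dots> = (\<Sum>w\<in>A. if I = L w then basis_class e n I else 0)"
      by (intro sum.cong refl) simp
    finally show "qscale (qvec.representation ?B (\<Sum>w\<in>A. x_elem e n (L w)) (x_elem e n I))
        (basis_class e n I) = (\<Sum>w\<in>A. if I = L w then basis_class e n I else 0)" .
  qed
  also have "\<dots> = (\<Sum>w\<in>A. \<Sum>I\<in>Pow (simple_roots e n). if I = L w then basis_class e n I else 0)"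
    by (rule sum.swap)
  also have "\<dots> = (\<Sum>w\<in>A. basis_class e n (L w))"
    using assms finite_simple_roots by (intro sum.cong refl) simp
  finally show ?thesis .
qed

section \<open>Classes of conjugate subsets\<close>

lemma weyl_conj_refl: "weyl_conj e n K K"
  unfolding weyl_conj_def by (rule bexI[of _ id]) (simp_all add: id_in_reflection_group)

lemma weyl_conj_sym:
  assumes "weyl_conj e n K L"
  shows "weyl_conj e n L K"
proof -
  obtain w where w: "w \<in> weyl_group e n" "L = w ` K"
    using assms by (auto simp: weyl_conj_def)
  then have "K = w\<^sup>- ` L"
    using reflection_group_inv_simps(2)[OF w(1)] by (simp add: image_image)
  then show ?thesis
    using inv_in_reflection_group[OF w(1)] by (auto simp: weyl_conj_def)
qed

lemma weyl_conj_trans: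
  assumes "weyl_conj e n I K" "weyl_conj e n K L"
  shows "weyl_conj e n I L"
proof -
  obtain v w where vw: "v \<in> weyl_group e n" "K = v ` I" "w \<in> weyl_group e n" "L = w ` K"
    using assms by (auto simp: weyl_conj_def)
  then have "L = (w \<circ> v) ` I" by (simp add: image_comp)
  then show ?thesis
    using comp_in_reflection_group[OF vw(3,1)] unfolding weyl_conj_def by blast
qed

lemma basis_class_cong:
  assumes "weyl_conj e n K L"
  shows "basis_class e n K = basis_class e n L"
proof -
  have "weyl_conj e n K I \<longleftrightarrow> weyl_conj e n L I" for I
    using assms weyl_conj_sym weyl_conj_trans by blast
  then show ?thesis by (simp add: basis_class_def x_class_def)
qed

section \<open>Existence and uniqueness of distinguished double coset representatives\<close>

lemma double_coset_rep_exists: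
  assumes K: "K \<subseteq> simple_roots e n" and N: "N \<subseteq> simple_roots e n" and w: "w \<in> weyl_group e n"
  obtains a b where "a \<in> parabolic K" "b \<in> parabolic N" "a \<circ> w \<circ> b \<in> double_coset_reps e n K N"
proof -
  have w': "w\<^sup>- \<in> weyl_group e n" using w by (rule inv_in_reflection_group)
  obtain c a where ca: "c \<in> coset_reps e n K" "a \<in> parabolic K" "w\<^sup>- = c \<circ> a"
    using parabolic_decomposition[OF K w'] by blast
  have cW: "c \<in> weyl_group e n" using ca(1) by (rule coset_repsD)
  have c': "c\<^sup>- \<in> {w \<in> weyl_group e n. w\<^sup>- \<in> coset_reps e n K}"
    using ca(1) cW reflection_group_inv_simps(3)[OF cW] inv_in_reflection_group[OF cW] by simp
  obtain d v where dv: "d \<in> double_coset_reps e n K N" "v \<in> parabolic N" "c\<^sup>- = d \<circ> v"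
    using c'[folded bij_betw_imp_surj_on[OF double_coset_decomposition[OF K N]]] by auto
  have "w = (c \<circ> a)\<^sup>-"
    using reflection_group_inv_simps(3)[OF w] ca(3) by simp
  also have "\<dots> = a\<^sup>- \<circ> c\<^sup>-"
    using cW ca(2) parabolic_subset[OF K] by (intro reflection_group_inv_comp[of _ "roots e n"]) auto
  finally have "a \<circ> w \<circ> v\<^sup>- = (a \<circ> a\<^sup>-) \<circ> d \<circ> (v \<circ> v\<^sup>-)"
    by (simp add: dv(3) comp_assoc)
  then have "a \<circ> w \<circ> v\<^sup>- = d"
    using reflection_group_inv_simps(4)[OF ca(2)] reflection_group_inv_simps(4)[OF dv(2)] by simp
  then show thesis
    using that[OF ca(2) inv_in_reflection_group[OF dv(2)]] dv(1) by simp
qed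

text \<open>The factors a and b are not unique, so b is normalised first: its part z in W_M can be
  moved through w' into W_K. The remaining part c lies in X_M, so (w' c^-1)^-1 lies in X_K, and
  uniqueness of single coset factorizations applies twice, for K and then for N.\<close>

lemma double_coset_rep_unique:
  assumes K: "K \<subseteq> simple_roots e n" and N: "N \<subseteq> simple_roots e n"
    and w: "w \<in> double_coset_reps e n K N" and w': "w' \<in> double_coset_reps e n K N"
    and a: "a \<in> parabolic K" and b: "b \<in> parabolic N" and eq: "w' = a \<circ> w \<circ> b"
  shows "w' = w"
proof -
  define M where "M = w'\<^sup>- ` K \<inter> N"
  have M: "M \<subseteq> simple_roots e n" using N by (auto simp: M_def)
  have W: "w \<in> weyl_group e n" "w' \<in> weyl_group e n" "a \<in> weyl_group e n" "b \<in> weyl_group e n"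
    using double_coset_repsD[OF w] double_coset_repsD[OF w'] a b
      parabolic_subset[OF K] parabolic_subset[OF N] by auto
  obtain c z where cz: "c \<in> coset_reps e n M" "z \<in> parabolic M" "b = c \<circ> z"
    using parabolic_decomposition[OF M W(4)] by blast
  have zN: "z \<in> parabolic N"
    using cz(2) reflection_group_mono[of M N] by (auto simp: M_def)
  have zW: "z \<in> weyl_group e n" using zN parabolic_subset[OF N] by blast
  have cW: "c \<in> weyl_group e n" using cz(1) by (rule coset_repsD)
  have c_eq: "c = b \<circ> z\<^sup>-"
    using reflection_group_inv_simps(4)[OF zN] cz(3) by (simp add: comp_assoc)
  have cN: "c \<in> parabolic N"
    unfolding c_eq using b zN by (intro comp_in_reflection_group inv_in_reflection_group)
  have c'N: "c\<^sup>- \<in> parabolic N" using cN by (rule inv_in_reflection_group)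
  have cc: "(c\<^sup>-)\<^sup>- = c" using cN by (rule reflection_group_inv_simps(3))
  have x: "(w' \<circ> c\<^sup>-)\<^sup>- \<in> coset_reps e n K"
    using double_coset_rep_mult[OF K N w' c'N] cz(1) by (simp add: cc M_def)
  \<comment> \<open>Since w' sends M into K, conjugating z^-1 by w' lands in W_K; this gives a w = y
    w' c^-1.\<close>
  define y where "y = w' \<circ> z\<^sup>- \<circ> w'\<^sup>-"
  have y: "y \<in> parabolic K"
    unfolding y_def
  proof (rule reflection_group_conj)
    show "z\<^sup>- \<in> parabolic M" using cz(2) by (rule inv_in_reflection_group)
    show "orthogonal_transformation w'" using W(2) by (rule reflection_group_orthogonal)
    show "w' ` M \<subseteq> K" using reflection_group_inv_simps(1)[OF W(2)] by (auto simp: M_def)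
  qed
  have yW: "y \<in> weyl_group e n" using y parabolic_subset[OF K] by blast
  have z'W: "z\<^sup>- \<in> weyl_group e n" using zW by (rule inv_in_reflection_group)
  have c'W: "c\<^sup>- \<in> weyl_group e n" using cW by (rule inv_in_reflection_group)
  have w'c: "w' \<circ> c\<^sup>- \<in> weyl_group e n" using W(2) c'W by (rule comp_in_reflection_group)
  have ids: "b \<circ> b\<^sup>- = id" "w'\<^sup>- \<circ> w' = id"
    using reflection_group_inv_simps(4)[OF W(4)] reflection_group_inv_simps(5)[OF W(2)] .
  have "a \<circ> w = (a \<circ> w \<circ> b) \<circ> b\<^sup>-"
    by (simp add: comp_assoc ids(1))
  also have "\<dots> = w' \<circ> (z\<^sup>- \<circ> c\<^sup>-)"
    using reflection_group_inv_comp[OF cW zW] by (simp add: eq[symmetric] cz(3)[symmetric])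
  also have "\<dots> = w' \<circ> z\<^sup>- \<circ> (w'\<^sup>- \<circ> w') \<circ> c\<^sup>-"
    by (simp add: ids(2) comp_assoc)
  also have "\<dots> = y \<circ> (w' \<circ> c\<^sup>-)"
    by (simp add: y_def comp_assoc)
  finally have "(a \<circ> w)\<^sup>- = (y \<circ> (w' \<circ> c\<^sup>-))\<^sup>-" by (rule arg_cong)
  then have "w\<^sup>- \<circ> a\<^sup>- = (w' \<circ> c\<^sup>-)\<^sup>- \<circ> y\<^sup>-"
    by (simp only: reflection_group_inv_comp[OF W(3,1)] reflection_group_inv_comp[OF yW w'c])
  moreover have "w\<^sup>- \<in> coset_reps e n K" using w by (simp add: double_coset_reps_iff)
  ultimately have "w\<^sup>- = (w' \<circ> c\<^sup>-)\<^sup>-"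
    using parabolic_decomposition_unique(1)[OF K _ x inv_in_reflection_group[OF a]
        inv_in_reflection_group[OF y]] by blast
  then have "w = w' \<circ> c\<^sup>-"
    using reflection_group_inv_simps(3)[OF W(1)] reflection_group_inv_simps(3)[OF w'c] by metis
  then have "w \<circ> id = w' \<circ> c\<^sup>-" by simp
  moreover have "w \<in> coset_reps e n N" "w' \<in> coset_reps e n N"
    using w w' by (simp_all add: double_coset_reps_iff)
  ultimately show "w' = w"
    using parabolic_decomposition_unique(1)[OF N _ _ id_in_reflection_group c'N] by metis
qed

section \<open>Roots in spans and conjugacy of subsets\<close>

lemma pos_root_inner_omega_nonneg:
  assumes "r \<in> pos_roots e n" "k \<le> n"
  shows "0 \<le> r \<bullet> omega k"
  using assms(1)
  by (rule pos_rootE) (use assms(2) in \<open>auto simp: inner_diff_left inner_e_omega\<close>)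

lemma pos_root_in_spanI:
  assumes r: "r \<in> pos_roots e n"
    and omega: "\<And>k. k \<in> {1..n} \<Longrightarrow> e k - e (Suc k) \<notin> J \<Longrightarrow> r \<bullet> omega k = 0"
  shows "r \<in> span J"
proof -
  obtain i j where ij: "i \<in> indices" "j \<in> indices" "i < j" "r = e i - e j"
    using r by (rule pos_rootE)
  have "e k - e (Suc k) \<in> J" if k: "k \<in> {i..<j}" for k
  proof (rule ccontr)
    assume "e k - e (Suc k) \<notin> J"
    then have "r \<bullet> omega k = 0"
      using ij(1,2) k by (intro omega) (auto simp: indices_iff)
    moreover have "k \<le> n" using ij(2) k by (auto simp: indices_iff)
    ultimately show False
      using ij(1,2) k by (simp add: ij(4) inner_diff_left inner_e_omega)
  qed
  then have "(\<Sum>k\<in>{i..<j}. e k - e (Suc k)) \<in> span J"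
    by (intro span_sum span_base)
  then show ?thesis
    by (simp only: ij(4) root_telescope[OF less_imp_le[OF ij(3)]])
qed

text \<open>Replaces a set of simple roots by spans, which W_K and W_N preserve. A positive root of
  span N is a sum of simple roots of N, all made positive by w. If the image is in span K, their
  nonnegative coefficients outside K add up to 0, so each image lies in span K, and by height in
  K.\<close>

lemma span_Int_double_coset_rep:
  assumes K: "K \<subseteq> simple_roots e n" and N: "N \<subseteq> simple_roots e n"
    and w: "w \<in> double_coset_reps e n K N" and r: "r \<in> roots e n"
  shows "r \<in> span (w\<^sup>- ` K \<inter> N) \<longleftrightarrow> r \<in> span N \<and> w r \<in> span K"
proof
  have W: "w \<in> weyl_group e n" using w by (rule double_coset_repsD)
  have lin: "linear w" using W by (rule reflection_group_linear)
  {
    assume *: "r \<in> span (w\<^sup>- ` K \<inter> N)"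
    have "w ` (w\<^sup>- ` K \<inter> N) \<subseteq> K"
      using reflection_group_inv_simps(1)[OF W] by auto
    then have "w ` span (w\<^sup>- ` K \<inter> N) \<subseteq> span K"
      by (simp add: span_mono flip: linear_span_image[OF lin])
    then show "r \<in> span N \<and> w r \<in> span K"
      using * span_mono[of "w\<^sup>- ` K \<inter> N" N] by auto
  next
    have pos: "p \<in> span (w\<^sup>- ` K \<inter> N)"
      if p: "p \<in> pos_roots e n" "p \<in> span N" "w p \<in> span K" for p
    proof -
      obtain i j where ij: "i \<in> indices" "j \<in> indices" "i < j" "p = e i - e j"
        using p(1) by (rule pos_rootE)
      have tel: "p = (\<Sum>k\<in>{i..<j}. e k - e (Suc k))"
        using root_telescope[OF less_imp_le[OF ij(3)]] by (simp only: ij(4))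
      have kN: "e k - e (Suc k) \<in> N" if "k \<in> {i..<j}" for k
        using simple_roots_of_pos_root_in_span[OF N ij(1,2) p(2)[unfolded ij(4)] that] .
      then have wpos: "w (e k - e (Suc k)) \<in> pos_roots e n" if "k \<in> {i..<j}" for k
        using w that by (simp add: double_coset_reps_iff coset_reps_iff)
      have "e k - e (Suc k) \<in> w\<^sup>- ` K" if k: "k \<in> {i..<j}" for k
      proof -
        have "w (e k - e (Suc k)) \<in> span K"
        proof (rule pos_root_in_spanI[OF wpos[OF k]])
          fix m assume m: "m \<in> {1..n}" "e m - e (Suc m) \<notin> K"
          have "w p = (\<Sum>k\<in>{i..<j}. w (e k - e (Suc k)))"
            by (subst tel) (rule linear_sum[OF lin])
          then have "(\<Sum>k\<in>{i..<j}. w (e k - e (Suc k)) \<bullet> omega m) = 0"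
            using inner_omega_span[OF K m p(3)] by (simp add: inner_sum_left)
          then show "w (e k - e (Suc k)) \<bullet> omega m = 0"
            using k m(1) pos_root_inner_omega_nonneg[OF wpos, of _ m]
            by (subst (asm) sum_nonneg_eq_0_iff) auto
        qed
        moreover have "w\<^sup>- (w (e k - e (Suc k))) \<in> simple_roots e n"
          using kN[OF k] N by (subst reflection_group_inv_simps(2)[OF W]) blast
        moreover have "w\<^sup>- \<in> coset_reps e n K" "w (e k - e (Suc k)) \<in> roots e n"
          using w wpos[OF k] by (simp_all add: double_coset_reps_iff pos_roots_iff_rho)
        ultimately have "w (e k - e (Suc k)) \<in> K"
          using coset_rep_simple_imp_simple[OF K] by blast
        then show ?thesis
          using reflection_group_inv_simps(2)[OF W, of "e k - e (Suc k)"] by (metis imageI)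
      qed
      then show ?thesis
        unfolding tel using kN by (intro span_sum span_base) blast
    qed
    assume *: "r \<in> span N \<and> w r \<in> span K"
    show "r \<in> span (w\<^sup>- ` K \<inter> N)"
    proof (cases "r \<in> pos_roots e n")
      case True
      then show ?thesis using * pos by blast
    next
      case False
      then have "- r \<in> pos_roots e n" using r root_pos_or_neg by blast
      moreover have "- r \<in> span N" "w (- r) \<in> span K"
        using * by (simp_all add: span_neg linear_neg[OF lin])
      ultimately have "- r \<in> span (w\<^sup>- ` K \<inter> N)" by (rule pos)
      then show ?thesis using span_neg by fastforce
    qed
  }
qed

text \<open>\<open>g\<close> matches the roots of two spans but need not match the simple ones.
  Removing its factor in W_I, which preserves span I, leaves h in X_I. By height h^-1 sends L into
  I; hence h^-1 is in X_L, and the same argument sends I into L.\<close>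

lemma weyl_conj_if_span_conj:
  assumes I: "I \<subseteq> simple_roots e n" and L: "L \<subseteq> simple_roots e n" and g: "g \<in> weyl_group e n"
    and span: "\<And>r. r \<in> roots e n \<Longrightarrow> g r \<in> span L \<longleftrightarrow> r \<in> span I"
  shows "weyl_conj e n I L"
proof -
  obtain h c where hc: "h \<in> coset_reps e n I" "c \<in> parabolic I" "g = h \<circ> c"
    using parabolic_decomposition[OF I g] by blast
  have W: "h \<in> weyl_group e n" "c \<in> weyl_group e n"
    using hc coset_repsD parabolic_subset[OF I] by auto
  have W': "h\<^sup>- \<in> weyl_group e n" "c\<^sup>- \<in> weyl_group e n"
    using W by (auto intro: inv_in_reflection_group)
  have h_span: "h r \<in> span L \<longleftrightarrow> r \<in> span I" if "r \<in> roots e n" for r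
  proof -
    have "g (c\<^sup>- r) = h r"
      using reflection_group_inv_simps(1)[OF W(2)] by (simp add: hc(3))
    moreover have "c\<^sup>- r \<in> roots e n"
      using W'(2) that by (rule weyl_group_root)
    ultimately show ?thesis
      using span[of "c\<^sup>- r"] reflection_group_span_iff[OF inv_in_reflection_group[OF hc(2)]] by simp
  qed
  have h'_root: "h\<^sup>- s \<in> roots e n" "h\<^sup>- s \<in> span I" if s: "s \<in> L" for s
  proof -
    show root: "h\<^sup>- s \<in> roots e n"
      using s L simple_subset_roots by (intro weyl_group_root[OF W'(1)]) blast
    show "h\<^sup>- s \<in> span I"
      using h_span[OF root] s reflection_group_inv_simps(1)[OF W(1), of s] by (simp add: span_base)
  qed
  have h'L: "h\<^sup>- ` L \<subseteq> I"
  proof (rule image_subsetI)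
    fix s assume s: "s \<in> L"
    then have "h (h\<^sup>- s) \<in> simple_roots e n"
      using L reflection_group_inv_simps(1)[OF W(1), of s] by auto
    then show "h\<^sup>- s \<in> I"
      using coset_rep_simple_imp_simple[OF I hc(1) h'_root[OF s]] by blast
  qed
  have h': "h\<^sup>- \<in> coset_reps e n L"
    using h'L I simple_subset_pos W'(1) by (auto simp: coset_reps_iff)
  have "h ` I \<subseteq> L"
  proof (rule image_subsetI)
    fix s assume s: "s \<in> I"
    have root: "s \<in> roots e n" using s I simple_subset_roots by blast
    show "h s \<in> L"
    proof (rule coset_rep_simple_imp_simple[OF L h'])
      show "h s \<in> roots e n" using W(1) root by (rule weyl_group_root)
      show "h s \<in> span L" using h_span[OF root] s by (simp add: span_base)
      show "h\<^sup>- (h s) \<in> simple_roots e n"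
        using s I reflection_group_inv_simps(2)[OF W(1), of s] by auto
    qed
  qed
  moreover have "L \<subseteq> h ` I"
  proof
    fix s assume s: "s \<in> L"
    then have "s = h (h\<^sup>- s)" "h\<^sup>- s \<in> I"
      using h'L reflection_group_inv_simps(1)[OF W(1), of s] by auto
    then show "s \<in> h ` I" by blast
  qed
  ultimately show ?thesis
    using W(1) unfolding weyl_conj_def by blast
qed

text \<open>\<open>f\<close> sends w to the distinguished representative of the double coset of u w
  v^-1. Conjugation by u and v brings W_K' and W_N' back into W_K and W_N, so
  \<open>f x = f y\<close> puts x into the double coset of y.\<close>

lemma double_coset_transport:
  assumes K: "K \<subseteq> simple_roots e n" and N: "N \<subseteq> simple_roots e n"
    and K': "K' \<subseteq> simple_roots e n" and N': "N' \<subseteq> simple_roots e n"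
    and conj: "weyl_conj e n K K'" "weyl_conj e n N N'"
  obtains f where "f ` double_coset_reps e n K N \<subseteq> double_coset_reps e n K' N'"
    "inj_on f (double_coset_reps e n K N)"
    "\<And>w. w \<in> double_coset_reps e n K N \<Longrightarrow>
      basis_class e n ((f w)\<^sup>- ` K' \<inter> N') = basis_class e n (w\<^sup>- ` K \<inter> N)"
proof -
  obtain u where u: "u \<in> weyl_group e n" "K' = u ` K" using conj(1) by (auto simp: weyl_conj_def)
  obtain v where v: "v \<in> weyl_group e n" "N' = v ` N" using conj(2) by (auto simp: weyl_conj_def)
  have v': "v\<^sup>- \<in> weyl_group e n" using v(1) by (rule inv_in_reflection_group)
  let ?R = "\<lambda>w w' a b. w' \<in> double_coset_reps e n K' N' \<and> a \<in> parabolic K' \<and> b \<in> parabolic N'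
    \<and> w' = a \<circ> (u \<circ> w \<circ> v\<^sup>-) \<circ> b"
  have "\<exists>w' a b. ?R w w' a b" if w: "w \<in> double_coset_reps e n K N" for w
  proof -
    have "u \<circ> w \<circ> v\<^sup>- \<in> weyl_group e n"
      by (rule comp_in_reflection_group[OF comp_in_reflection_group[OF u(1) double_coset_repsD[OF w]] v'])
    then show ?thesis
      using double_coset_rep_exists[OF K' N'] by metis
  qed
  then obtain f A B where f: "\<And>w. w \<in> double_coset_reps e n K N \<Longrightarrow> ?R w (f w) (A w) (B w)"
    by metis
  have ids: "u\<^sup>- \<circ> u = id" "v\<^sup>- \<circ> v = id"
    using reflection_group_inv_simps(5)[OF u(1)] reflection_group_inv_simps(5)[OF v(1)] .
  show thesis
  proof (rule that)
    show "f ` double_coset_reps e n K N \<subseteq> double_coset_reps e n K' N'"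
      using f by blast
    show "inj_on f (double_coset_reps e n K N)"
    proof (rule inj_onI)
      fix x y assume xy: "x \<in> double_coset_reps e n K N" "y \<in> double_coset_reps e n K N" "f x = f y"
      note fx = f[OF xy(1)] and fy = f[OF xy(2)]
      have conjK: "u\<^sup>- \<circ> a \<circ> u \<in> parabolic K" if "a \<in> parabolic K'" for a
        using reflection_group_conj[OF that, of "u\<^sup>-" K] u
          reflection_group_orthogonal[OF inv_in_reflection_group[OF u(1)]]
          reflection_group_inv_simps(2,3)[OF u(1)] by (simp add: image_image)
      have conjN: "v\<^sup>- \<circ> b \<circ> v \<in> parabolic N" if "b \<in> parabolic N'" for b
        using reflection_group_conj[OF that, of "v\<^sup>-" N] v
          reflection_group_orthogonal[OF inv_in_reflection_group[OF v(1)]]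
          reflection_group_inv_simps(2,3)[OF v(1)] by (simp add: image_image)
      have Ax: "A x \<in> parabolic K'" and Ay: "A y \<in> parabolic K'"
        and Bx: "B x \<in> parabolic N'" and By: "B y \<in> parabolic N'"
        using fx fy by blast+
      have "A x (u (x (v\<^sup>- (B x z)))) = A y (u (y (v\<^sup>- (B y z))))" for z
        using fx fy xy(3) by (metis comp_apply)
      note * = this[of "(B x)\<^sup>- (v z)" for z]
      have x: "x z = u\<^sup>- (((A x)\<^sup>- \<circ> A y) (u (y (v\<^sup>- ((B y \<circ> (B x)\<^sup>-) (v z))))))" for z
      proof -
        have "A x (u (x z)) = A y (u (y (v\<^sup>- (B y ((B x)\<^sup>- (v z))))))"
          using *[of z] reflection_group_inv_simps(1)[OF Bx] reflection_group_inv_simps(2)[OF v(1)]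
          by simp
        then have "x z = u\<^sup>- ((A x)\<^sup>- (A y (u (y (v\<^sup>- (B y ((B x)\<^sup>- (v z))))))))"
          using reflection_group_inv_simps(2)[OF Ax, of "u (x z)"]
            reflection_group_inv_simps(2)[OF u(1), of "x z"] by simp
        then show ?thesis by simp
      qed
      have "x = (u\<^sup>- \<circ> ((A x)\<^sup>- \<circ> A y) \<circ> u) \<circ> y \<circ> (v\<^sup>- \<circ> (B y \<circ> (B x)\<^sup>-) \<circ> v)"
        by (rule ext) (simp add: x[simplified])
      moreover have "(A x)\<^sup>- \<circ> A y \<in> parabolic K'" "B y \<circ> (B x)\<^sup>- \<in> parabolic N'"
        using Ax Ay Bx By comp_in_reflection_group inv_in_reflection_group by blast+
      ultimately show "x = y"
        using double_coset_rep_unique[OF K N xy(2,1) conjK conjN] by blast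
    qed
  next
    fix w assume w: "w \<in> double_coset_reps e n K N"
    define w' where "w' = f w"
    note fw = f[OF w, folded w'_def]
    have w': "w' \<in> double_coset_reps e n K' N'" and A: "A w \<in> parabolic K'" and B: "B w \<in> parabolic N'"
      and w'_eq: "w' = A w \<circ> (u \<circ> w \<circ> v\<^sup>-) \<circ> B w"
      using fw by blast+
    \<comment> \<open>Chosen so that w' g = A u w (with A for \<open>A w\<close>): g r is in span N'
      iff r is in span N, and w' g r is in span K' iff w r is in span K. By
      \<open>span_Int_double_coset_rep\<close>, g then matches the roots of the spans of the two
      intersections.\<close>
    define g where "g = (B w)\<^sup>- \<circ> v"
    have B': "(B w)\<^sup>- \<in> parabolic N'" using B by (rule inv_in_reflection_group)
    have g: "g \<in> weyl_group e n"
      unfolding g_def using B' parabolic_subset[OF N'] v(1) by (intro comp_in_reflection_group) auto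
    have "weyl_conj e n (w\<^sup>- ` K \<inter> N) (w'\<^sup>- ` K' \<inter> N')"
    proof (rule weyl_conj_if_span_conj[OF _ _ g])
      show "w\<^sup>- ` K \<inter> N \<subseteq> simple_roots e n" "w'\<^sup>- ` K' \<inter> N' \<subseteq> simple_roots e n"
        using N N' by auto
      fix r assume r: "r \<in> roots e n"
      have span_image: "h x \<in> span (h ` S) \<longleftrightarrow> x \<in> span S" if "h \<in> weyl_group e n" for h x S
        using linear_span_image[OF reflection_group_linear[OF that]] reflection_group_bij[OF that]
        by (simp add: bij_is_inj inj_image_mem_iff)
      have "g r \<in> span N' \<longleftrightarrow> r \<in> span N"
        using reflection_group_span_iff[OF B'] span_image[OF v(1)] by (simp add: g_def v(2))
      moreover have "w' (g r) = A w (u (w r))"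
        using reflection_group_inv_simps(1)[OF B] reflection_group_inv_simps(2)[OF v(1)]
        by (simp add: w'_eq g_def)
      then have "w' (g r) \<in> span K' \<longleftrightarrow> w r \<in> span K"
        using reflection_group_span_iff[OF A] span_image[OF u(1)] by (simp add: u(2))
      ultimately show "g r \<in> span (w'\<^sup>- ` K' \<inter> N') \<longleftrightarrow> r \<in> span (w\<^sup>- ` K \<inter> N)"
        using span_Int_double_coset_rep[OF K N w r]
          span_Int_double_coset_rep[OF K' N' w' weyl_group_root[OF g r]] by simp
    qed
    then show "basis_class e n ((f w)\<^sup>- ` K' \<inter> N') = basis_class e n (w\<^sup>- ` K \<inter> N)"
      using basis_class_cong by (simp add: w'_def)
  qed
qed

text \<open>Injections in both directions between finite sets make the transport map a bijection,
  and it preserves each summand.\<close>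

lemma sum_basis_class_double_coset_cong:
  assumes K: "K \<subseteq> simple_roots e n" and N: "N \<subseteq> simple_roots e n"
    and K': "K' \<subseteq> simple_roots e n" and N': "N' \<subseteq> simple_roots e n"
    and conj: "weyl_conj e n K K'" "weyl_conj e n N N'"
  shows "(\<Sum>w\<in>double_coset_reps e n K' N'. basis_class e n (w\<^sup>- ` K' \<inter> N'))
    = (\<Sum>w\<in>double_coset_reps e n K N. basis_class e n (w\<^sup>- ` K \<inter> N))"
proof -
  obtain f where f: "f ` double_coset_reps e n K N \<subseteq> double_coset_reps e n K' N'"
    "inj_on f (double_coset_reps e n K N)"
    "\<And>w. w \<in> double_coset_reps e n K N \<Longrightarrow>
      basis_class e n ((f w)\<^sup>- ` K' \<inter> N') = basis_class e n (w\<^sup>- ` K \<inter> N)"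
    using double_coset_transport[OF K N K' N' conj] by blast
  obtain f' where f': "f' ` double_coset_reps e n K' N' \<subseteq> double_coset_reps e n K N"
    "inj_on f' (double_coset_reps e n K' N')"
    by (rule double_coset_transport[OF K' N' K N conj[THEN weyl_conj_sym]])
  have "card (double_coset_reps e n K' N') \<le> card (f ` double_coset_reps e n K N)"
    using card_inj_on_le[OF f'(2,1) finite_double_coset_reps] card_image[OF f(2)] by simp
  then have img: "f ` double_coset_reps e n K N = double_coset_reps e n K' N'"
    by (rule card_seteq[OF finite_double_coset_reps f(1)])
  have "(\<Sum>w\<in>double_coset_reps e n K' N'. basis_class e n (w\<^sup>- ` K' \<inter> N'))
      = (\<Sum>w\<in>double_coset_reps e n K N. basis_class e n ((f w)\<^sup>- ` K' \<inter> N'))"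
    by (subst img[symmetric]) (simp only: sum.reindex[OF f(2)] o_def)
  also have "\<dots> = (\<Sum>w\<in>double_coset_reps e n K N. basis_class e n (w\<^sup>- ` K \<inter> N))"
    by (intro sum.cong refl f(3))
  finally show ?thesis .
qed

text \<open>Any two representatives give the same bracket by
  \<open>sum_basis_class_double_coset_cong\<close>, and the classes are nonempty, so the definite
  description has exactly one solution.\<close>

lemma class_prod_x_class:
  assumes K: "K \<subseteq> simple_roots e n" and N: "N \<subseteq> simple_roots e n"
  shows "class_prod e n (x_class e n K) (x_class e n N)
    = (\<Sum>w\<in>double_coset_reps e n K N. basis_class e n (w\<^sup>- ` K \<inter> N))"
proof -
  let ?z = "\<Sum>w\<in>double_coset_reps e n K N. basis_class e n (w\<^sup>- ` K \<inter> N)"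
  have brk: "bracket e n (group_alg_mult (x_elem e n K') (x_elem e n N'))
      = (\<Sum>w\<in>double_coset_reps e n K' N'. basis_class e n (w\<^sup>- ` K' \<inter> N'))"
    if "K' \<subseteq> simple_roots e n" "N' \<subseteq> simple_roots e n" for K' N'
    unfolding mult_x_elem[OF that] using that by (intro bracket_sum_x_elem) auto
  show ?thesis
    unfolding class_prod_def
  proof (rule the_equality)
    show "\<forall>x\<in>x_class e n K. \<forall>y\<in>x_class e n N. ?z = bracket e n (group_alg_mult x y)"
    proof (intro ballI)
      fix x y assume "x \<in> x_class e n K" "y \<in> x_class e n N"
      then obtain K' N' where K': "x = x_elem e n K'" "K' \<subseteq> simple_roots e n" "weyl_conj e n K K'"
        and N': "y = x_elem e n N'" "N' \<subseteq> simple_roots e n" "weyl_conj e n N N'"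
        unfolding x_class_def by blast
      show "?z = bracket e n (group_alg_mult x y)"
        unfolding K'(1) N'(1) brk[OF K'(2) N'(2)]
        by (rule sum_basis_class_double_coset_cong[OF K N K'(2) N'(2) K'(3) N'(3), symmetric])
    qed
  next
    fix z assume z: "\<forall>x\<in>x_class e n K. \<forall>y\<in>x_class e n N. z = bracket e n (group_alg_mult x y)"
    have "x_elem e n K \<in> x_class e n K" "x_elem e n N \<in> x_class e n N"
      using K N weyl_conj_refl unfolding x_class_def by blast+
    then show "z = ?z" using z brk[OF K N] by auto
  qed
qed

text \<open>Representatives are grouped by the subset P, not by its class: conjugate P contribute
  separate terms with the same basis element.\<close>

lemma class_mult_basis_class:
  assumes K: "K \<subseteq> simple_roots e n" and N: "N \<subseteq> simple_roots e n"
  shows "class_mult e n (basis_class e n K) (basis_class e n N)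
    = (\<Sum>P\<in>Pow N. qscale (of_nat (struct_const e n K N P)) (basis_class e n P))"
proof -
  have "class_mult e n (basis_class e n K) (basis_class e n N)
      = class_prod e n (x_class e n K) (x_class e n N)"
    by (simp add: class_mult_def basis_class_def)
  also have "\<dots> = (\<Sum>w\<in>double_coset_reps e n K N. basis_class e n (w\<^sup>- ` K \<inter> N))"
    by (rule class_prod_x_class[OF K N])
  also have "\<dots> = (\<Sum>P\<in>Pow N. \<Sum>w\<in>{w \<in> double_coset_reps e n K N. w\<^sup>- ` K \<inter> N = P}.
      basis_class e n (w\<^sup>- ` K \<inter> N))"
    using finite_double_coset_reps finite_subset[OF N finite_simple_roots]
    by (intro sum.group[symmetric]) auto
  also have "\<dots> = (\<Sum>P\<in>Pow N. qscale (of_nat (struct_const e n K N P)) (basis_class e n P))"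
  proof (intro sum.cong refl)
    fix P
    have "(\<Sum>w\<in>{w \<in> double_coset_reps e n K N. w\<^sup>- ` K \<inter> N = P}. basis_class e n (w\<^sup>- ` K \<inter> N))
        = (\<Sum>w\<in>{w \<in> double_coset_reps e n K N. w\<^sup>- ` K \<inter> N = P}. basis_class e n P)"
      by (intro sum.cong refl) auto
    also have "\<dots> = qscale (of_nat (struct_const e n K N P)) (basis_class e n P)"
      unfolding struct_const_def by (rule qvec.sum_constant_scale)
    finally show "(\<Sum>w\<in>{w \<in> double_coset_reps e n K N. w\<^sup>- ` K \<inter> N = P}.
        basis_class e n (w\<^sup>- ` K \<inter> N)) = qscale (of_nat (struct_const e n K N P)) (basis_class e n P)" .
  qed
  finally show ?thesis .
qed

end

theorem theorem2p1:
  fixes e :: "nat \<Rightarrow> 'a::euclidean_space" and n :: nat and J K N :: "'a set"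
  assumes "DIM('a) = n + 1"
    and "\<And>i j. i \<in> {1..n+1} \<Longrightarrow> j \<in> {1..n+1} \<Longrightarrow> e i \<bullet> e j = (if i = j then 1 else 0)"
    and "K \<subseteq> simple_roots e n" and "N \<subseteq> simple_roots e n"
    and "J \<subseteq> simple_roots e n" and "N \<subseteq> J"
  shows "class_mult e n (basis_class e n K) (basis_class e n N) =
           (\<Sum>P\<in>Pow N.
              qscale (of_nat (\<Sum>M\<in>Pow J. struct_const e n K J M * struct_const_rel e n J M N P))
                     (basis_class e n P))
       \<and> (\<forall>P. P \<subseteq> simple_roots e n \<longrightarrow>
            struct_const e n K N P =
              (\<Sum>M\<in>Pow J. struct_const e n K J M * struct_const_rel e n J M N P))"
proof -
  interpret type_A e n
    using assms(1,2) by unfold_locales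
  show ?thesis
    using class_mult_basis_class[OF assms(3,4)] struct_const_parabolic[OF assms(3,5,6)] by simp
qed

end
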